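(* Consider the mechanical control system without outputs $$(\mathcal{MS})\qquad \dot x=v,\qquad \dot v=-v^T\Gamma(x)v+e(x)+\sum_{r=1}^m g_r(x)u_r,$$ on $\mathrm{T}Q$, $\dim Q=n$, and let $x_0\in Q$. The system $(\mathcal{MS})$ is, locally around $x_0$, MF-linearizable if and only if there exist $m$ functions $h_1,\ldots,h_m\in C^\infty(Q)$ for which (MF1) the vector relative half-degree $(\nu_1,\ldots,\nu_m)$ of $(\mathcal{MS})$, with $h=(h_1,\ldots,h_m)$ considered as its output, is well defined (around $x_0$) and satisfies $\sum_{\ell=1}^m\nu_\ell=n$; (MF2) $\nabla(dL_e^k h_\ell)=0$ for $1\le\ell\le m$ and $0\le k\le\nu_\ell-2$.
   Context: All objects are $C^\infty$-smooth. $Q$ is an $n$-dimensional manifold (configuration manifold) with local coordinates $x=(x^1,\ldots,x^n)$, and $(x,v)$ are the induced coordinates on the tangent bundle $\mathrm{T}Q$. $\nabla$ is a symmetric affine connection on $Q$ (not necessarily metric) with Christoffel symbols $\Gamma^i_{jk}=\Gamma^i_{kj}$; the $i$-th component of $v^T\Gamma(x)v$ is $\Gamma^i_{jk}(x)v^jv^k$ (summation over repeated indices from $1$ to $n$). $e$ and $g_1,\ldots,g_m$ are vector fields on $Q$; $u=(u_1,\ldots,u_m)\in\mathbb{R}^m$ is the control. Lie derivatives $L_e$, $L_{g_r}$ are those of functions on $Q$. Covariant derivative: for a function $f$ on $Q$, $\nabla df=\big(\frac{\partial^2 f}{\partial x^j\partial x^k}-\Gamma^i_{jk}\frac{\partial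 f}{\partial x^i}\big)dx^j\otimes dx^k$. Vector relative half-degree: $(\mathcal{MS})$ equipped with an output map $h=(h_1,\ldots,h_m):Q\to\mathbb{R}^m$ has the vector relative half-degree $(\nu_1,\ldots,\nu_m)$ around $x_0$ if (i) $L_{g_r}L_e^q h_\ell=0$ for $1\le\ell,r\le m$ and $0\le q\le\nu_\ell-2$, and (ii) the $m\times m$ matrix $D(x)=\big(L_{g_r}L_e^{\nu_\ell-1}h_\ell\big)(x)$ is of full rank $m$ around $x_0$. Mechanical feedback transformations consist of (i) mechanical diffeomorphisms $(x,v)\mapsto(\tilde x,\tilde v)=\big(\phi(x),\frac{\partial\phi}{\partial x}(x)v\big)$, where $\phi:Q\to\tilde Q$ is a diffeomorphism; (ii) mechanical static feedback $u_r=v^T\gamma^r(x)v+\alpha^r(x)+\sum_{s=1}^m\beta^r_s(x)\tilde u_s$, where $\gamma^r_{jk}=\gamma^r_{kj}$, $\alpha^r$, $\beta^r_s$ are smooth functions on $Q$ and the matrix $(\beta^r_s(x))$ is invertible. MF-linearizability (mechanical feedback linearizability), locally around $x_0$: the system $(\mathcal{MS})$ can be transformed, locally around $x_0$, by mechanical feedback transformations (a mechanical diffeomorphism together with a mechanical static feedback) into a linear mechanical system, that is, one of the form $\dot{\tilde x}=\tilde v$, $\dot{\tilde v}=E\tilde x+B\tilde u$ with constant matrices $E$ and $B$.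
   Formalization: MF-linearizable is taken to mean transformable into a controllable linear mechanical system with rank B = m; with arbitrary constant E, B the "only if" fails (n = m = 1, Γ = 0, e = 0, g_1 = 0 is linear but has no half-degree). *)

theory Defs
  imports "HOL-Analysis.Analysis"
begin

section \<open>Smooth maps\<close>

text \<open>Intended for open sets \<open>S\<close>: all iterated directional derivatives up to order \<open>k\<close> exist and
  are continuous on \<open>S\<close>.\<close>

fun Ck_on :: "nat \<Rightarrow> 'a::real_normed_vector set \<Rightarrow> ('a \<Rightarrow> 'b::real_normed_vector) \<Rightarrow> bool" where
  "Ck_on 0 S f \<longleftrightarrow> continuous_on S f"
| "Ck_on (Suc k) S f \<longleftrightarrow>
     (\<forall>x\<in>S. f differentiable (at x)) \<and> (\<forall>v. Ck_on k S (\<lambda>x. frechet_derivative f (at x) v))"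

definition smooth_on :: "'a::real_normed_vector set \<Rightarrow> ('a \<Rightarrow> 'b::real_normed_vector) \<Rightarrow> bool" where
  "smooth_on S f \<longleftrightarrow> (\<forall>k. Ck_on k S f)"

definition smooth_diffeo_on :: "'a::real_normed_vector set \<Rightarrow> ('a \<Rightarrow> 'b::real_normed_vector) \<Rightarrow> bool" where
  "smooth_diffeo_on S f \<longleftrightarrow> open S \<and> inj_on f S \<and> smooth_on S f \<and>
     open (f ` S) \<and> smooth_on (f ` S) (inv_into S f)"


section \<open>Manifolds, vector fields and affine connections\<close>

text \<open>The manifold is the whole type \<open>'q\<close>. A chart is a pair of a domain \<open>U\<close> and a map \<open>\<phi>\<close> whose
  values outside \<open>U\<close> are irrelevant.\<close>

type_synonym ('q, 'n) chart = "'q set \<times> ('q \<Rightarrow> real^'n)"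

definition chart_image :: "('q, 'n::finite) chart \<Rightarrow> (real^'n) set" where
  "chart_image c = snd c ` fst c"

definition chart_inv :: "('q, 'n::finite) chart \<Rightarrow> real^'n \<Rightarrow> 'q" where
  "chart_inv c = inv_into (fst c) (snd c)"

definition transition :: "('q, 'n::finite) chart \<Rightarrow> ('q, 'n) chart \<Rightarrow> real^'n \<Rightarrow> real^'n" where
  "transition c d = snd d \<circ> chart_inv c"

definition smooth_atlas ::
    "('q::{t2_space,second_countable_topology}, 'n::finite) chart set \<Rightarrow> bool" where
  "smooth_atlas A \<longleftrightarrow>
     (\<Union>c\<in>A. fst c) = UNIV \<and>
     (\<forall>c\<in>A. open (fst c) \<and> open (chart_image c) \<and>
        homeomorphism (fst c) (chart_image c) (snd c) (chart_inv c)) \<and>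
     (\<forall>c\<in>A. \<forall>d\<in>A. smooth_on (snd c ` (fst c \<inter> fst d)) (transition c d))"

definition smooth_function :: "('q, 'n::finite) chart set \<Rightarrow> ('q \<Rightarrow> real) \<Rightarrow> bool" where
  "smooth_function A f \<longleftrightarrow> (\<forall>c\<in>A. smooth_on (chart_image c) (f \<circ> chart_inv c))"

text \<open>A vector field is given by its components \<open>X c\<close> in every chart \<open>c\<close>, as functions of the
  coordinates, subject to the usual transformation law.\<close>

definition smooth_vector_field ::
    "('q, 'n::finite) chart set \<Rightarrow> (('q, 'n) chart \<Rightarrow> real^'n \<Rightarrow> real^'n) \<Rightarrow> bool" where
  "smooth_vector_field A X \<longleftrightarrow>
     (\<forall>c\<in>A. smooth_on (chart_image c) (X c)) \<and>
     (\<forall>c\<in>A. \<forall>d\<in>A. \<forall>q \<in> fst c \<inter> fst d.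
        X d (snd d q) = frechet_derivative (transition c d) (at (snd c q)) (X c (snd c q)))"

text \<open>Christoffel symbols at a point are stored as \<open>G $ i $ j $ k\<close>, with \<open>i\<close> the upper index.
  The \<open>i\<close>-th component of \<open>quad G v w\<close> is the sum over \<open>j\<close> and \<open>k\<close> of
  \<open>G $ i $ j $ k * v $ j * w $ k\<close>.\<close>

definition quad :: "real^'n^'n^'i \<Rightarrow> real^'n::finite \<Rightarrow> real^'n \<Rightarrow> real^'i::finite" where
  "quad G v w = (\<chi> i. v \<bullet> (G $ i *v w))"

text \<open>The last conjunct is the transformation law of Christoffel symbols under \<open>y = \<tau>(x)\<close>:
  \<open>D\<tau> (\<Gamma>(v,w)) = D\<^sup>2\<tau> (v,w) + \<Gamma>'(D\<tau> v, D\<tau> w)\<close>.\<close>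

definition symmetric_connection ::
    "('q, 'n::finite) chart set \<Rightarrow> (('q, 'n) chart \<Rightarrow> real^'n \<Rightarrow> real^'n^'n^'n) \<Rightarrow> bool" where
  "symmetric_connection A \<Gamma> \<longleftrightarrow>
     (\<forall>c\<in>A. smooth_on (chart_image c) (\<Gamma> c)) \<and>
     (\<forall>c\<in>A. \<forall>x\<in>chart_image c. \<forall>i j k. \<Gamma> c x $ i $ j $ k = \<Gamma> c x $ i $ k $ j) \<and>
     (\<forall>c\<in>A. \<forall>d\<in>A. \<forall>q \<in> fst c \<inter> fst d. \<forall>v w.
        (let \<tau> = transition c d; x = snd c q; D = (\<lambda>y. frechet_derivative \<tau> (at y))
         in D x (quad (\<Gamma> c x) v w) =
            frechet_derivative (\<lambda>y. D y v) (at x) w + quad (\<Gamma> d (snd d q)) (D x v) (D x w)))"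


section \<open>Differential operators in coordinates\<close>

definition lie :: "(real^'n \<Rightarrow> real^'n) \<Rightarrow> (real^'n \<Rightarrow> real) \<Rightarrow> real^'n::finite \<Rightarrow> real" where
  "lie X f x = frechet_derivative f (at x) (X x)"

definition partial :: "'n \<Rightarrow> (real^'n \<Rightarrow> real) \<Rightarrow> real^'n::finite \<Rightarrow> real" where
  "partial j f x = frechet_derivative f (at x) (axis j 1)"

definition nabla_d ::
    "(real^'n \<Rightarrow> real^'n^'n^'n) \<Rightarrow> (real^'n \<Rightarrow> real) \<Rightarrow> real^'n::finite \<Rightarrow> real^'n^'n" where
  "nabla_d \<Gamma> f x =
     (\<chi> j k. partial j (partial k f) x - (\<Sum>i\<in>UNIV. \<Gamma> x $ i $ j $ k * partial i f x))"

definition decoupling_matrix ::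
    "(real^'n \<Rightarrow> real^'n) \<Rightarrow> ('m \<Rightarrow> real^'n \<Rightarrow> real^'n) \<Rightarrow> ('m \<Rightarrow> real^'n \<Rightarrow> real) \<Rightarrow> ('m \<Rightarrow> nat)
      \<Rightarrow> real^'n::finite \<Rightarrow> real^'m^'m::finite" where
  "decoupling_matrix e g h \<nu> x = (\<chi> l r. lie (g r) ((lie e ^^ (\<nu> l - 1)) (h l)) x)"

text \<open>The guard \<open>q + 2 \<le> \<nu> l\<close> avoids truncated subtraction in \<open>q \<le> \<nu> l - 2\<close>.\<close>

definition has_half_degree ::
    "(real^'n \<Rightarrow> real^'n) \<Rightarrow> ('m \<Rightarrow> real^'n \<Rightarrow> real^'n) \<Rightarrow> ('m \<Rightarrow> real^'n \<Rightarrow> real) \<Rightarrow> real^'n::finite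
      \<Rightarrow> ('m::finite \<Rightarrow> nat) \<Rightarrow> bool" where
  "has_half_degree e g h p \<nu> \<longleftrightarrow>
     (\<forall>l. 1 \<le> \<nu> l) \<and>
     (\<forall>\<^sub>F x in nhds p. \<forall>l r q. q + 2 \<le> \<nu> l \<longrightarrow> lie (g r) ((lie e ^^ q) (h l)) x = 0) \<and>
     (\<forall>\<^sub>F x in nhds p. rank (decoupling_matrix e g h \<nu> x) = CARD('m))"


section \<open>Mechanical systems and mechanical feedback linearization\<close>

definition mechanical_system ::
    "(real^'n \<Rightarrow> real^'n^'n^'n) \<Rightarrow> (real^'n \<Rightarrow> real^'n) \<Rightarrow> ('m \<Rightarrow> real^'n \<Rightarrow> real^'n)
      \<Rightarrow> (real^'n) \<times> (real^'n) \<Rightarrow> real^'m \<Rightarrow> (real^'n::finite) \<times> (real^'n)" where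
  "mechanical_system \<Gamma> e g = (\<lambda>(x, v) u.
     (v, - quad (\<Gamma> x) v v + e x + (\<Sum>r\<in>UNIV. (u $ r) *\<^sub>R g r x)))"

definition linear_mechanical_system ::
    "real^'n^'n \<Rightarrow> real^'m^'n \<Rightarrow> (real^'n) \<times> (real^'n) \<Rightarrow> real^'m \<Rightarrow> (real^'n::finite) \<times> (real^'n)" where
  "linear_mechanical_system E B = (\<lambda>(x, v) u. (v, E *v x + B *v u))"

definition tangent_map ::
    "(real^'n \<Rightarrow> real^'n) \<Rightarrow> (real^'n) \<times> (real^'n) \<Rightarrow> (real^'n::finite) \<times> (real^'n)" where
  "tangent_map \<psi> = (\<lambda>(x, v). (\<psi> x, frechet_derivative \<psi> (at x) v))"

definition mechanical_feedback ::
    "(real^'n \<Rightarrow> real^'n^'n^'m) \<Rightarrow> (real^'n \<Rightarrow> real^'m) \<Rightarrow> (real^'n \<Rightarrow> real^'m^'m)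
      \<Rightarrow> (real^'n::finite) \<times> (real^'n) \<Rightarrow> real^'m \<Rightarrow> real^'m" where
  "mechanical_feedback \<gamma> \<alpha> \<beta> = (\<lambda>(x, v) w. quad (\<gamma> x) v v + \<alpha> x + \<beta> x *v w)"

text \<open>The closed-loop dynamics on the tangent bundle is pushed forward by the tangent map of \<open>\<psi>\<close>
  to the linear dynamics, for every value of the new control \<open>w\<close>. All transformations are
  defined on some neighbourhood \<open>V\<close> of \<open>p\<close> inside the coordinate domain \<open>S\<close>.\<close>

definition mf_equivalent_to_linear ::
    "(real^'n) set \<Rightarrow> (real^'n \<Rightarrow> real^'n^'n^'n) \<Rightarrow> (real^'n \<Rightarrow> real^'n)
      \<Rightarrow> ('m \<Rightarrow> real^'n \<Rightarrow> real^'n) \<Rightarrow> real^'n \<Rightarrow> real^'n^'n \<Rightarrow> real^'m^'n::finite \<Rightarrow> bool" where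
  "mf_equivalent_to_linear S \<Gamma> e g p E B \<longleftrightarrow>
     (\<exists>V \<psi> \<gamma> \<alpha> \<beta>. open V \<and> p \<in> V \<and> V \<subseteq> S \<and> smooth_diffeo_on V \<psi> \<and>
        smooth_on V \<gamma> \<and> smooth_on V \<alpha> \<and> smooth_on V \<beta> \<and>
        (\<forall>x\<in>V. (\<forall>r j k. \<gamma> x $ r $ j $ k = \<gamma> x $ r $ k $ j) \<and> invertible (\<beta> x)) \<and>
        (\<forall>x\<in>V. \<forall>v w.
           frechet_derivative (tangent_map \<psi>) (at (x, v))
             (mechanical_system \<Gamma> e g (x, v) (mechanical_feedback \<gamma> \<alpha> \<beta> (x, v) w)) =
           linear_mechanical_system E B (tangent_map \<psi> (x, v)) w))"

text \<open>Kalman's rank condition: the columns of \<open>B, E B, \<dots>, E\<^sup>n\<^sup>-\<^sup>1 B\<close> span the whole space. For a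
  linear mechanical system this is equivalent to the rank condition for the first-order system in
  \<open>(x, v)\<close>. (The power operation on type \<open>real^'n^'n\<close> is componentwise, so powers of \<open>E\<close> are
  written as iterated application.)\<close>

definition controllable :: "real^'n^'n \<Rightarrow> real^'m::finite^'n::finite \<Rightarrow> bool" where
  "controllable E B \<longleftrightarrow>
     span {((*v) E ^^ k) (column j B) |k j. k < CARD('n)} = UNIV"

text \<open>The linear target is required to be controllable with independent controls. Without this,
  the system with vanishing connection, \<open>e = 0\<close> and \<open>g\<^sub>r = 0\<close> would be linearizable although no
  output has a well-defined vector relative half-degree.\<close>

definition mf_linearizable ::
    "(real^'n) set \<Rightarrow> (real^'n \<Rightarrow> real^'n^'n^'n) \<Rightarrow> (real^'n \<Rightarrow> real^'n)
      \<Rightarrow> ('m::finite \<Rightarrow> real^'n \<Rightarrow> real^'n) \<Rightarrow> real^'n::finite \<Rightarrow> bool" where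
  "mf_linearizable S \<Gamma> e g p \<longleftrightarrow>
     (\<exists>E (B :: real^'m^'n). controllable E B \<and> rank B = CARD('m) \<and>
        mf_equivalent_to_linear S \<Gamma> e g p E B)"

end

theory Submission
  imports Defs
begin

text \<open>Along a motion of the system, the second time derivative of a function \<open>f\<close> of the configuration
is \<open>(\<nabla>df)(v,v) + L\<^sub>e f + \<Sum>\<^sub>r u\<^sub>r L\<^bsub>g\<^sub>r\<^esub> f\<close>. Put \<open>z\<^bsub>l,k\<^esub> = L\<^sub>e\<^sup>k h\<^sub>l\<close> for
\<open>k < \<nu>\<^sub>l\<close>. For \<open>k \<le> \<nu>\<^sub>l - 2\<close> the two conditions remove the quadratic term and the control terms,
so that \<open>z\<^bsub>l,k\<^esub>\<close> has second time derivative \<open>z\<^bsub>l,k+1\<^esub>\<close>. For \<open>k = \<nu>\<^sub>l - 1\<close> the control enters through the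
\<open>l\<close>-th row of the invertible decoupling matrix, and a feedback that is quadratic in \<open>v\<close> gives these
functions an arbitrary second derivative. The \<open>z\<^bsub>l,k\<^esub>\<close> are \<open>n\<close> functions, so they turn the
system into \<open>m\<close> chains of double integrators as soon as their differentials are independent
(\<open>half_degree_imp_mf_linearizable\<close>).

Independence is usually derived from iterated brackets of \<open>e\<close> and \<open>g\<^sub>r\<close>. Here it is a pointwise
fact: since \<open>d(L\<^sub>e f)(w) = (\<nabla>df)(w,e) + df(\<nabla>\<^sub>w e)\<close>, the condition \<open>\<nabla>dz\<^bsub>l,k\<^esub> = 0\<close> says
\<open>dz\<^bsub>l,k+1\<^esub> = dz\<^bsub>l,k\<^esub> \<circ> M\<close> with the linear map \<open>M w = \<nabla>\<^sub>w e\<close>. Hence at each point \<open>dz\<^bsub>l,k\<^esub>\<close> is the image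
of \<open>dz\<^bsub>l,0\<^esub>\<close> under the \<open>k\<close>-th power of the adjoint of \<open>M\<close>, and the half-degree conditions are those of
\<open>output_chains\<close>, for which \<open>output_chains_independent\<close> holds by linear algebra. The inverse function
theorem, with smooth inverse (\<open>smooth_local_diffeo\<close>), then provides the coordinates.

Conversely, a controllable pair \<open>(E, B)\<close> admits covectors \<open>c\<^sub>l\<close> for which the covectors
\<open>c\<^sub>l E\<^sup>k\<close> with \<open>k < \<nu>\<^sub>l\<close> form a basis, \<open>c\<^sub>l E\<^sup>k B = 0\<close> for \<open>k \<le> \<nu>\<^sub>l - 2\<close>, and the \<open>c\<^sub>l E\<^bsup>\<nu>\<^sub>l-1\<^esup> B\<close> are
independent. This is the dual form of Brunovsky's theorem; it is proved in
\<open>exists_output_chains_basis\<close> by making the total length of the chains as large as possible. With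
linearizing coordinates \<open>\<psi>\<close> put \<open>h\<^sub>l = c\<^sub>l \<psi>\<close>. A covector that annihilates \<open>B\<close> does not see the
feedback, so \<open>L\<^sub>e\<^sup>k h\<^sub>l = c\<^sub>l E\<^sup>k \<psi>\<close> for \<open>k < \<nu>\<^sub>l\<close>, and for \<open>k \<le> \<nu>\<^sub>l - 2\<close> the quadratic part of the
dynamics forces \<open>(\<nabla>dL\<^sub>e\<^sup>k h\<^sub>l)(v,v) = 0\<close> for all \<open>v\<close>. Polarization finishes the argument, because
\<open>\<nabla>df\<close> is symmetric for a symmetric connection (\<open>second_derivative_symmetric\<close>). The functions \<open>h\<^sub>l\<close>
exist only near the point at first; a bump function extends them to the
whole manifold without changing them near the point (\<open>smooth_function_extension\<close>).\<close>

section \<open>Maps with continuous iterated directional derivatives\<close>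

text \<open>At points where no derivative exists, both sides are the same arbitrary choice, so iterated Lie
derivatives are local operators without side conditions.\<close>
lemma frechet_derivative_cong_open:
  assumes "open S" "x \<in> S" "\<And>y. y \<in> S \<Longrightarrow> f y = g y"
  shows "frechet_derivative f (at x) = frechet_derivative g (at x)"
proof -
  have "(f has_derivative D) (at x) \<longleftrightarrow> (g has_derivative D) (at x)" for D
    using has_derivative_transform_within_open[OF _ assms(1,2)] assms(3) by metis
  then show ?thesis
    by (simp add: frechet_derivative_def)
qed

lemma differentiable_cong_open:
  assumes "open S" "x \<in> S" "\<And>y. y \<in> S \<Longrightarrow> f y = g y" "f differentiable (at x)"
  shows "g differentiable (at x)"
  using has_derivative_transform_within_open[OF _ assms(1,2)] assms(3,4)
  unfolding differentiable_def by metis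

lemma Ck_on_cong:
  assumes "open S" "\<And>x. x \<in> S \<Longrightarrow> f x = g x" "Ck_on k S f"
  shows "Ck_on k S g"
  using assms(2,3)
proof (induction k arbitrary: f g)
  case 0
  then show ?case by (metis Ck_on.simps(1) continuous_on_cong)
next
  case (Suc k)
  have "Ck_on k S (\<lambda>x. frechet_derivative g (at x) v)" for v
    using Suc.IH[of "\<lambda>x. frechet_derivative f (at x) v" "\<lambda>x. frechet_derivative g (at x) v"]
      Suc.prems frechet_derivative_cong_open[OF \<open>open S\<close>, of _ f g] by simp
  then show ?case
    using Suc.prems differentiable_cong_open[OF \<open>open S\<close>, of _ f g] by auto
qed

text \<open>The working form of the recursion: the derivative may be given by any formula that is valid on
the open set \<open>S\<close>.\<close>
lemma Ck_on_SucI: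
  assumes "open S" "\<And>x. x \<in> S \<Longrightarrow> (f has_derivative f' x) (at x)"
    and "\<And>v. Ck_on k S (\<lambda>x. f' x v)"
  shows "Ck_on (Suc k) S f"
proof -
  have "Ck_on k S (\<lambda>x. frechet_derivative f (at x) v)" for v
    by (rule Ck_on_cong[OF assms(1) _ assms(3)[of v]]) (metis assms(2) frechet_derivative_at)
  then show ?thesis
    using assms(2) by (auto simp: differentiable_def)
qed

lemma Ck_on_Suc_has_derivative:
  assumes "Ck_on (Suc k) S f" "x \<in> S"
  shows "(f has_derivative frechet_derivative f (at x)) (at x)"
  using assms frechet_derivative_works by auto

lemma Ck_on_SucD: "Ck_on (Suc k) S f \<Longrightarrow> Ck_on k S f"
proof (induction k arbitrary: f)
  case 0
  then show ?case
    by (auto intro!: continuous_at_imp_continuous_on differentiable_imp_continuous_within)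
next
  case (Suc k)
  then show ?case by auto
qed

lemma Ck_on_subset: "Ck_on k S f \<Longrightarrow> T \<subseteq> S \<Longrightarrow> Ck_on k T f"
  by (induction k arbitrary: f) (auto intro: continuous_on_subset)

lemma Ck_on_local:
  assumes "\<And>x. x \<in> S \<Longrightarrow> \<exists>T. open T \<and> x \<in> T \<and> Ck_on k T f"
  shows "Ck_on k S f"
  using assms
proof (induction k arbitrary: f)
  case 0
  then show ?case
    by (metis Ck_on.simps(1) continuous_at_imp_continuous_on continuous_on_eq_continuous_at)
next
  case (Suc k)
  have "Ck_on k S (\<lambda>x. frechet_derivative f (at x) v)" for v
    using Suc.prems by (intro Suc.IH) force
  moreover have "f differentiable (at x)" if "x \<in> S" for x
    using Suc.prems[OF that] by auto
  ultimately show ?case by simp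
qed

lemma Ck_on_const [simp]: "Ck_on k S (\<lambda>x. c)"
  by (induction k arbitrary: c) auto

lemma Ck_on_bounded_linear:
  assumes "open S" "bounded_linear L" "Ck_on k S f"
  shows "Ck_on k S (\<lambda>x. L (f x))"
  using assms(3)
proof (induction k arbitrary: f)
  case 0
  then show ?case
    using assms(2) by (auto intro: linear_continuous_on_compose bounded_linear.linear
        bounded_linear.continuous_on)
next
  case (Suc k)
  show ?case
  proof (rule Ck_on_SucI[OF \<open>open S\<close>])
    show "((\<lambda>x. L (f x)) has_derivative (\<lambda>v. L (frechet_derivative f (at x) v))) (at x)"
      if "x \<in> S" for x
      using bounded_linear.has_derivative[OF assms(2) Ck_on_Suc_has_derivative[OF Suc.prems that]] .
    show "Ck_on k S (\<lambda>x. L (frechet_derivative f (at x) v))" for v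
      using Suc.prems by (intro Suc.IH) simp
  qed
qed

lemma Ck_on_id: "open S \<Longrightarrow> Ck_on k S (\<lambda>x. x)"
proof (cases k)
  case (Suc k')
  assume "open S"
  then show ?thesis
    unfolding Suc by (rule Ck_on_SucI[where f'="\<lambda>x v. v"]) auto
qed simp

lemma Ck_on_add:
  assumes "open S" "Ck_on k S f" "Ck_on k S g"
  shows "Ck_on k S (\<lambda>x. f x + g x)"
  using assms(2,3)
proof (induction k arbitrary: f g)
  case 0
  then show ?case by (auto intro: continuous_intros)
next
  case (Suc k)
  show ?case
  proof (rule Ck_on_SucI[OF \<open>open S\<close> has_derivative_add])
    show "(f has_derivative frechet_derivative f (at x)) (at x)"
      "(g has_derivative frechet_derivative g (at x)) (at x)" if "x \<in> S" for x
      using Suc.prems that by (auto intro: Ck_on_Suc_has_derivative simp del: Ck_on.simps)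
    show "Ck_on k S (\<lambda>x. frechet_derivative f (at x) v + frechet_derivative g (at x) v)" for v
      using Suc.prems by (intro Suc.IH) simp_all
  qed
qed

lemma Ck_on_sum:
  assumes "open S" "\<And>i. i \<in> I \<Longrightarrow> Ck_on k S (f i)"
  shows "Ck_on k S (\<lambda>x. \<Sum>i\<in>I. f i x)"
  using assms(2)
  by (induction I rule: infinite_finite_induct) (auto intro!: Ck_on_add[OF \<open>open S\<close>])

lemma Ck_on_bilinear:
  assumes "open S" "bounded_bilinear B" "Ck_on k S f" "Ck_on k S g"
  shows "Ck_on k S (\<lambda>x. B (f x) (g x))"
  using assms(3,4)
proof (induction k arbitrary: f g)
  case 0
  then show ?case using bounded_bilinear.continuous_on[OF assms(2)] by simp
next
  case (Suc k)
  show ?case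
  proof (rule Ck_on_SucI[OF \<open>open S\<close>])
    show "((\<lambda>x. B (f x) (g x)) has_derivative
        (\<lambda>v. B (f x) (frechet_derivative g (at x) v) + B (frechet_derivative f (at x) v) (g x))) (at x)"
      if "x \<in> S" for x
      using Suc.prems that
      by (intro bounded_bilinear.FDERIV[OF assms(2)] Ck_on_Suc_has_derivative)
    show "Ck_on k S (\<lambda>x. B (f x) (frechet_derivative g (at x) v)
        + B (frechet_derivative f (at x) v) (g x))" for v
      using Suc.prems Ck_on_SucD[OF Suc.prems(1)] Ck_on_SucD[OF Suc.prems(2)]
      by (intro Ck_on_add[OF \<open>open S\<close>] Suc.IH) simp_all
  qed
qed

lemmas Ck_on_scaleR = Ck_on_bilinear[OF _ bounded_bilinear_scaleR]
lemmas Ck_on_mult = Ck_on_bilinear[OF _ bounded_bilinear_mult]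

lemma Ck_on_prod:
  fixes f :: "'i \<Rightarrow> 'a::real_normed_vector \<Rightarrow> real"
  assumes "open S" "\<And>i. i \<in> I \<Longrightarrow> Ck_on k S (f i)"
  shows "Ck_on k S (\<lambda>x. \<Prod>i\<in>I. f i x)"
  using assms(2)
  by (induction I rule: infinite_finite_induct) (auto intro!: Ck_on_mult[OF \<open>open S\<close>])

text \<open>The recursion controls the derivative of \<open>g\<close> only in fixed directions, while the chain rule
applies it to the varying direction \<open>Df(x) v\<close>. Expanding that direction in an orthonormal basis
reduces to fixed directions; this is why the intermediate space is Euclidean.\<close>
lemma Ck_on_compose:
  fixes f :: "'a::real_normed_vector \<Rightarrow> 'b::euclidean_space"
  assumes "open S" "open T" "f ` S \<subseteq> T" "Ck_on k S f" "Ck_on k T g"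
  shows "Ck_on k S (\<lambda>x. g (f x))"
  using assms(4,5)
proof (induction k arbitrary: g)
  case 0
  then show ?case
    using assms(3) by (auto intro: continuous_on_compose2)
next
  case (Suc k)
  define f' where "f' = (\<lambda>x. frechet_derivative f (at x))"
  define g' where "g' = (\<lambda>y. frechet_derivative g (at y))"
  have f': "(f has_derivative f' x) (at x)" if "x \<in> S" for x
    using Suc.prems(1) that unfolding f'_def by (rule Ck_on_Suc_has_derivative)
  have g': "(g has_derivative g' (f x)) (at (f x))" if "x \<in> S" for x
    using Suc.prems(2) that assms(3) unfolding g'_def by (intro Ck_on_Suc_has_derivative) auto
  show ?case
  proof (rule Ck_on_SucI[OF \<open>open S\<close>])
    fix x assume x: "x \<in> S"
    have D: "((\<lambda>x. g (f x)) has_derivative (\<lambda>v. g' (f x) (f' x v))) (at x)"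
      using diff_chain_at[OF f'[OF x] g'[OF x]] by (simp add: o_def)
    have expand: "g' (f x) w = (\<Sum>b\<in>Basis. (w \<bullet> b) *\<^sub>R g' (f x) b)" for w
    proof -
      interpret linear "g' (f x)"
        using g'[OF x] by (rule has_derivative_linear)
      have "g' (f x) w = g' (f x) (\<Sum>b\<in>Basis. (w \<bullet> b) *\<^sub>R b)"
        by (simp add: euclidean_representation)
      then show ?thesis by (simp add: sum scale)
    qed
    show "((\<lambda>x. g (f x)) has_derivative
        (\<lambda>v. \<Sum>b\<in>Basis. (f' x v \<bullet> b) *\<^sub>R g' (f x) b)) (at x)"
      using D unfolding expand[of "f' x _"] .
  next
    fix v
    have "Ck_on k S (\<lambda>x. g' (f x) b)" for b
      using Suc.prems(2) Ck_on_SucD[OF Suc.prems(1)] unfolding g'_def by (intro Suc.IH) simp_all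
    moreover have "Ck_on k S (\<lambda>x. f' x v)"
      using Suc.prems(1) unfolding f'_def by simp
    ultimately show "Ck_on k S (\<lambda>x. \<Sum>b\<in>Basis. (f' x v \<bullet> b) *\<^sub>R g' (f x) b)"
      using \<open>open S\<close>
      by (intro Ck_on_sum Ck_on_scaleR Ck_on_bounded_linear[OF _ bounded_linear_inner_left])
  qed
qed

lemma Ck_on_inverse:
  fixes f :: "'a::real_normed_vector \<Rightarrow> real"
  assumes "open S" "Ck_on k S f" "\<And>x. x \<in> S \<Longrightarrow> f x \<noteq> 0"
  shows "Ck_on k S (\<lambda>x. inverse (f x))"
  using assms(2)
proof (induction k)
  case 0
  then show ?case using assms(3) by (auto intro: continuous_intros)
next
  case (Suc k)
  show ?case
  proof (rule Ck_on_SucI[OF \<open>open S\<close>])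
    show "((\<lambda>x. inverse (f x)) has_derivative
        (\<lambda>v. - 1 * (inverse (f x) * frechet_derivative f (at x) v * inverse (f x)))) (at x)"
      if "x \<in> S" for x
      using Deriv.has_derivative_inverse[OF assms(3)[OF that] Ck_on_Suc_has_derivative[OF Suc.prems that]]
      by simp
    show "Ck_on k S (\<lambda>x. - 1 * (inverse (f x) * frechet_derivative f (at x) v * inverse (f x)))" for v
      using Suc Ck_on_SucD[OF Suc.prems] by (intro Ck_on_mult[OF \<open>open S\<close>]) auto
  qed
qed

lemma Ck_on_vec_lambda:
  fixes f :: "'i::finite \<Rightarrow> 'a::real_normed_vector \<Rightarrow> 'b::euclidean_space"
  assumes "open S" "\<And>i. Ck_on k S (f i)"
  shows "Ck_on k S (\<lambda>x. \<chi> i. f i x)"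
proof -
  have "bounded_linear (\<lambda>y::'b. axis i y :: 'b^'i)" for i
    by (rule linear_conv_bounded_linear[THEN iffD1], rule linearI) (auto simp: axis_def vec_eq_iff)
  then have "Ck_on k S (\<lambda>x. \<Sum>i\<in>UNIV. axis i (f i x))"
    by (intro Ck_on_sum[OF assms(1)] Ck_on_bounded_linear[OF assms(1) _ assms(2)])
  moreover have "(\<Sum>i\<in>UNIV. axis i (f i x)) = (\<chi> i. f i x)" for x
    by (simp add: vec_eq_iff axis_def if_distrib cong: if_cong)
  ultimately show ?thesis by simp
qed

lemma Ck_on_vec_nth: "open S \<Longrightarrow> Ck_on k S f \<Longrightarrow> Ck_on k S (\<lambda>x. f x $ i)"
  by (rule Ck_on_bounded_linear[OF _ bounded_linear_vec_nth])

lemma Ck_on_det: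
  fixes M :: "'a::real_normed_vector \<Rightarrow> real^'n^'n"
  assumes "open S" "\<And>i j. Ck_on k S (\<lambda>x. M x $ i $ j)"
  shows "Ck_on k S (\<lambda>x. det (M x))"
  unfolding det_def
  by (intro Ck_on_sum[OF assms(1)] Ck_on_mult[OF assms(1)] Ck_on_const Ck_on_prod[OF assms(1)] assms(2))

lemma matrix_inv:
  fixes M :: "real^'n^'n"
  assumes "invertible M"
  shows matrix_inv_left: "matrix_inv M ** M = mat 1"
    and matrix_inv_right: "M ** matrix_inv M = mat 1"
  using someI_ex[OF assms[unfolded invertible_def]] by (auto simp: matrix_inv_def)

text \<open>By Cramer's rule the entries of the inverse are quotients of polynomials in the entries of the
matrix.\<close>
lemma Ck_on_matrix_inv:
  fixes M :: "'a::real_normed_vector \<Rightarrow> real^'n^'n"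
  assumes "open S" "\<And>i j. Ck_on k S (\<lambda>x. M x $ i $ j)" "\<And>x. x \<in> S \<Longrightarrow> invertible (M x)"
  shows "Ck_on k S (\<lambda>x. matrix_inv (M x))"
proof -
  have eq: "matrix_inv (M x) = (\<chi> a b. det (\<chi> i j. if j = a then axis b 1 $ i else M x $ i $ j)
       * inverse (det (M x)))" if "x \<in> S" for x
  proof -
    have "M x *v column b (matrix_inv (M x)) = axis b 1" for b
      using matrix_inv_right[OF assms(3)[OF that]]
      by (simp add: matrix_vector_mul_assoc flip: matrix_vector_mult_basis)
    then have "column b (matrix_inv (M x)) =
        (\<chi> a. det (\<chi> i j. if j = a then axis b 1 $ i else M x $ i $ j) / det (M x))" for b
      using cramer[of "M x"] assms(3)[OF that] invertible_det_nz by blast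
    then show ?thesis
      by (simp add: column_def vec_eq_iff divide_inverse)
  qed
  have "Ck_on k S (\<lambda>x. \<chi> a b. det (\<chi> i j. if j = a then axis b 1 $ i else M x $ i $ j)
       * inverse (det (M x)))"
  proof (intro Ck_on_vec_lambda Ck_on_mult assms(1) Ck_on_inverse Ck_on_det)
    show "Ck_on k S (\<lambda>x. (\<chi> i j. if j = a then axis b 1 $ i else M x $ i $ j) $ i $ j)"
      for a b :: 'n and i j
      using assms(2) by (cases "j = a") auto
  qed (use assms in \<open>auto simp: invertible_det_nz\<close>)
  then show ?thesis
    by (rule Ck_on_cong[OF assms(1), rotated]) (simp add: eq)
qed

section \<open>Smooth maps\<close>

lemma bounded_bilinear_matrix_vector_mult:
  "bounded_bilinear ((*v) :: real^'n^'m \<Rightarrow> real^'n \<Rightarrow> real^'m)"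
  by (simp add: bilinear_conv_bounded_bilinear[symmetric] bilinear_def linear_iff
      matrix_vector_mult_add_rdistrib matrix_vector_right_distrib
      scaleR_matrix_vector_assoc[symmetric] matrix_vector_mult_scaleR)

lemma smooth_on_has_derivative:
  "smooth_on S f \<Longrightarrow> x \<in> S \<Longrightarrow> (f has_derivative frechet_derivative f (at x)) (at x)"
  using Ck_on_Suc_has_derivative unfolding smooth_on_def by blast

lemma smooth_on_frechet_derivative:
  "smooth_on S f \<Longrightarrow> smooth_on S (\<lambda>x. frechet_derivative f (at x) v)"
  unfolding smooth_on_def using Ck_on.simps(2) by blast

lemma smooth_on_continuous_on: "smooth_on S f \<Longrightarrow> continuous_on S f"
  unfolding smooth_on_def using Ck_on.simps(1) by blast

lemma smooth_on_cong:
  "open S \<Longrightarrow> (\<And>x. x \<in> S \<Longrightarrow> f x = g x) \<Longrightarrow> smooth_on S f \<Longrightarrow> smooth_on S g"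
  unfolding smooth_on_def using Ck_on_cong by blast

lemma smooth_on_subset: "smooth_on S f \<Longrightarrow> T \<subseteq> S \<Longrightarrow> smooth_on T f"
  unfolding smooth_on_def using Ck_on_subset by blast

lemma smooth_on_local:
  "(\<And>x. x \<in> S \<Longrightarrow> \<exists>T. open T \<and> x \<in> T \<and> smooth_on T f) \<Longrightarrow> smooth_on S f"
  unfolding smooth_on_def using Ck_on_local by meson

lemma smooth_on_const: "smooth_on S (\<lambda>x. c)"
  by (simp add: smooth_on_def)

lemma smooth_on_bounded_linear:
  "open S \<Longrightarrow> bounded_linear L \<Longrightarrow> smooth_on S f \<Longrightarrow> smooth_on S (\<lambda>x. L (f x))"
  unfolding smooth_on_def using Ck_on_bounded_linear by blast

lemma smooth_on_id: "open S \<Longrightarrow> smooth_on S (\<lambda>x. x)"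
  unfolding smooth_on_def using Ck_on_id by blast

lemma smooth_on_add:
  "open S \<Longrightarrow> smooth_on S f \<Longrightarrow> smooth_on S g \<Longrightarrow> smooth_on S (\<lambda>x. f x + g x)"
  unfolding smooth_on_def using Ck_on_add by blast

lemma smooth_on_sum:
  "open S \<Longrightarrow> (\<And>i. i \<in> I \<Longrightarrow> smooth_on S (f i)) \<Longrightarrow> smooth_on S (\<lambda>x. \<Sum>i\<in>I. f i x)"
  by (simp add: smooth_on_def Ck_on_sum)

lemma smooth_on_bilinear:
  "open S \<Longrightarrow> bounded_bilinear B \<Longrightarrow> smooth_on S f \<Longrightarrow> smooth_on S g \<Longrightarrow>
    smooth_on S (\<lambda>x. B (f x) (g x))"
  unfolding smooth_on_def using Ck_on_bilinear by blast

lemmas smooth_on_scaleR = smooth_on_bilinear[OF _ bounded_bilinear_scaleR]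
lemmas smooth_on_mult = smooth_on_bilinear[OF _ bounded_bilinear_mult]
lemmas smooth_on_inner = smooth_on_bilinear[OF _ bounded_bilinear_inner]

lemma smooth_on_uminus: "open S \<Longrightarrow> smooth_on S f \<Longrightarrow> smooth_on S (\<lambda>x. - f x)"
  by (rule smooth_on_bounded_linear[OF _ bounded_linear_minus[OF bounded_linear_ident]])

lemma smooth_on_diff:
  "open S \<Longrightarrow> smooth_on S f \<Longrightarrow> smooth_on S g \<Longrightarrow> smooth_on S (\<lambda>x. f x - g x)"
  using smooth_on_add[of S f "\<lambda>x. - g x"] smooth_on_uminus by auto

lemma smooth_on_compose:
  fixes f :: "'a::real_normed_vector \<Rightarrow> 'b::euclidean_space"
  shows "open S \<Longrightarrow> open T \<Longrightarrow> f ` S \<subseteq> T \<Longrightarrow> smooth_on S f \<Longrightarrow> smooth_on T g \<Longrightarrow>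
    smooth_on S (\<lambda>x. g (f x))"
  unfolding smooth_on_def using Ck_on_compose by blast

lemma smooth_on_inverse:
  fixes f :: "'a::real_normed_vector \<Rightarrow> real"
  shows "open S \<Longrightarrow> smooth_on S f \<Longrightarrow> (\<And>x. x \<in> S \<Longrightarrow> f x \<noteq> 0) \<Longrightarrow>
    smooth_on S (\<lambda>x. inverse (f x))"
  unfolding smooth_on_def using Ck_on_inverse by blast

lemma smooth_on_vec_lambda:
  fixes f :: "'i::finite \<Rightarrow> 'a::real_normed_vector \<Rightarrow> 'b::euclidean_space"
  shows "open S \<Longrightarrow> (\<And>i. smooth_on S (f i)) \<Longrightarrow> smooth_on S (\<lambda>x. \<chi> i. f i x)"
  unfolding smooth_on_def using Ck_on_vec_lambda by blast

lemma smooth_on_vec_nth: "open S \<Longrightarrow> smooth_on S f \<Longrightarrow> smooth_on S (\<lambda>x. f x $ i)"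
  by (rule smooth_on_bounded_linear[OF _ bounded_linear_vec_nth])

lemma smooth_on_matrix_inv:
  fixes M :: "'a::real_normed_vector \<Rightarrow> real^'n^'n"
  assumes "open S" "smooth_on S M" "\<And>x. x \<in> S \<Longrightarrow> invertible (M x)"
  shows "smooth_on S (\<lambda>x. matrix_inv (M x))"
  using assms unfolding smooth_on_def by (simp add: Ck_on_matrix_inv Ck_on_vec_nth)

section \<open>The inverse function theorem for smooth maps\<close>

text \<open>The classical theorem gives a local inverse \<open>g\<close> with \<open>Dg(y) = (Df(g y))\<^sup>-\<^sup>1\<close>. If \<open>g\<close> is \<open>C\<^sup>k\<close>, so is the
right-hand side, and therefore \<open>g\<close> is \<open>C\<^sup>k\<^sup>+\<^sup>1\<close>.\<close>
proposition smooth_local_diffeo: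
  fixes f :: "real^'n \<Rightarrow> real^'n"
  assumes "open S" "smooth_on S f" "p \<in> S" "inj (frechet_derivative f (at p))"
  obtains V where "open V" "p \<in> V" "V \<subseteq> S" "smooth_diffeo_on V f"
proof -
  define D where "D x = frechet_derivative f (at x)" for x
  have D: "(f has_derivative D x) (at x)" if "x \<in> S" for x
    using smooth_on_has_derivative[OF assms(2) that] by (simp add: D_def)
  have bl: "bounded_linear (D x)" if "x \<in> S" for x
    using D[OF that] by (rule has_derivative_bounded_linear)
  define F where "F x = Blinfun (D x)" for x
  have F: "blinfun_apply (F x) = D x" if "x \<in> S" for x
    using bounded_linear_Blinfun_apply[OF bl[OF that]] by (simp add: F_def)
  have "continuous_on S (\<lambda>x. F x i)" for i
    using smooth_on_continuous_on[OF smooth_on_frechet_derivative[OF assms(2), of i]]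
    by (simp add: F D_def cong: continuous_on_cong)
  then have contF: "continuous_on S F"
    by (intro continuous_on_blinfun_componentwise)
  obtain G where G: "linear G" "G \<circ> D p = id"
    using linear_injective_left_inverse[OF _ assms(4)] bl[OF assms(3)]
    by (auto simp: D_def bounded_linear.linear)
  then have "Blinfun G o\<^sub>L F p = id_blinfun"
    by (intro blinfun_eqI)
      (simp add: F[OF assms(3)] bounded_linear_Blinfun_apply linear_conv_bounded_linear pointfree_idE)
  then obtain V W g g' where V: "open V" "V \<subseteq> S" "p \<in> V" and W: "open W" "f p \<in> W"
    and hom: "homeomorphism V W f g"
    and g': "\<And>y. y \<in> W \<Longrightarrow> (g has_derivative (g' y)) (at y)"
      "\<And>y. y \<in> W \<Longrightarrow> g' y = inv (blinfun_apply (F (g y)))"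
      "\<And>y. y \<in> W \<Longrightarrow> bij (blinfun_apply (F (g y)))"
    using inverse_function_theorem[OF assms(1) _ contF assms(3)] D F by (metis (no_types, lifting))
  have fV: "f ` V = W" and gW: "g ` W = V" and gf: "\<And>x. x \<in> V \<Longrightarrow> g (f x) = x"
    and fg: "\<And>y. y \<in> W \<Longrightarrow> f (g y) = y"
    using hom by (auto simp: homeomorphism_def)
  have gS: "g y \<in> S" if "y \<in> W" for y
    using gW V(2) that by auto
  have inj: "inj_on f V"
    using gf by (metis inj_onI)
  have inv_mat: "invertible (matrix (D (g y)))" "g' y = (*v) (matrix_inv (matrix (D (g y))))"
    if "y \<in> W" for y
  proof -
    note y = gS[OF that]
    have D_mat: "D (g y) = (*v) (matrix (D (g y)))"
      using bl[OF y] by (simp add: bounded_linear.linear)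
    have bij: "bij (D (g y))" using g'(3)[OF that] F[OF y] by simp
    show inv: "invertible (matrix (D (g y)))"
      using bij bl[OF y] bounded_linear.linear matrix_invertible
      by (metis D_mat bij_def invertible_left_inverse matrix_left_invertible_injective)
    have "inv (D (g y)) = (*v) (matrix_inv (matrix (D (g y))))"
      by (rule inv_equality; subst D_mat)
        (simp_all only: matrix_vector_mul_assoc matrix_inv[OF inv] matrix_vector_mul_lid)
    then show "g' y = (*v) (matrix_inv (matrix (D (g y))))"
      using g'(2)[OF that] F[OF y] by simp
  qed
  have Ck_g: "Ck_on k W g" for k
  proof (induction k)
    case 0
    then show ?case using hom by (simp add: homeomorphism_def)
  next
    case (Suc k)
    have "Ck_on k W (\<lambda>y. matrix (D (g y)) $ i $ j)" for i j
    proof -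
      have "Ck_on k S (\<lambda>x. D x (axis j 1) $ i)"
        using smooth_on_frechet_derivative[OF assms(2), of "axis j 1"]
        unfolding smooth_on_def D_def by (intro Ck_on_vec_nth assms(1)) auto
      then have "Ck_on k W (\<lambda>y. D (g y) (axis j 1) $ i)"
        using gS by (intro Ck_on_compose[OF W(1) assms(1) _ Suc]) auto
      then show ?thesis by (simp add: matrix_def)
    qed
    then have C: "Ck_on k W (\<lambda>y. matrix_inv (matrix (D (g y))))"
      by (intro Ck_on_matrix_inv[OF W(1)]) (auto simp: inv_mat)
    show ?case
    proof (rule Ck_on_SucI[OF W(1)])
      show "(g has_derivative (*v) (matrix_inv (matrix (D (g y))))) (at y)" if "y \<in> W" for y
        using g'(1)[OF that] inv_mat(2)[OF that] by simp
      show "Ck_on k W (\<lambda>y. matrix_inv (matrix (D (g y))) *v w)" for w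
        using C by (intro Ck_on_bounded_linear[OF W(1), where L="\<lambda>M. M *v w"])
          (auto intro: bounded_bilinear.bounded_linear_left bounded_bilinear_matrix_vector_mult)
    qed
  qed
  have "smooth_on (f ` V) (inv_into V f)"
    unfolding fV smooth_on_def
  proof
    show "Ck_on k W (inv_into V f)" for k
    proof (rule Ck_on_cong[OF W(1) _ Ck_g])
      show "g y = inv_into V f y" if "y \<in> W" for y
        using that gW fg inj by (metis image_eqI inv_into_f_eq)
    qed
  qed
  then have "smooth_diffeo_on V f"
    using V W inj fV smooth_on_subset[OF assms(2)] by (auto simp: smooth_diffeo_on_def)
  then show thesis using that V by blast
qed

section \<open>Bump functions\<close>

text \<open>The functions \<open>t\<^sup>-\<^sup>j exp(-1/t)\<close>, extended by zero to \<open>t \<le> 0\<close>. Only \<open>j = 0\<close> is wanted, but the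
derivative of each member is a combination of the next two, so smoothness can be proved for the
whole family at once by induction on the order.\<close>
definition flat_exp :: "nat \<Rightarrow> real \<Rightarrow> real" where
  "flat_exp j t = (if t > 0 then inverse t ^ j * exp (- inverse t) else 0)"

lemma flat_exp_pos: "t > 0 \<Longrightarrow> flat_exp j t > 0"
  by (simp add: flat_exp_def)

lemma flat_exp_nonneg: "flat_exp j t \<ge> 0"
  by (simp add: flat_exp_def)

lemma flat_exp_deriv:
  "(flat_exp j has_field_derivative (flat_exp (j + 2) t - j * flat_exp (j + 1) t)) (at t)"
proof (cases t "0::real" rule: linorder_cases)
  case less
  have "((\<lambda>_. 0) has_field_derivative 0) (at t)" by simp
  then have "(flat_exp j has_field_derivative 0) (at t)"
    by (rule DERIV_cong_ev[THEN iffD1, rotated -1, OF _ refl])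
      (use less in \<open>auto simp: flat_exp_def eventually_nhds intro!: exI[of _ "{..<0}"]\<close>)
  then show ?thesis using less by (simp add: flat_exp_def)
next
  case greater
  have "((\<lambda>t. inverse t ^ j) has_field_derivative - (j * inverse t ^ (j + 1))) (at t)"
    using DERIV_power[OF DERIV_inverse[of t UNIV], of j] greater
    by (cases j) (auto simp: power2_eq_square mult_ac)
  moreover have "((\<lambda>t. exp (- inverse t)) has_field_derivative
      exp (- inverse t) * inverse t ^ 2) (at t)"
    using greater by (auto intro!: derivative_eq_intros simp: power2_eq_square)
  ultimately have "((\<lambda>t. inverse t ^ j * exp (- inverse t)) has_field_derivative
      (flat_exp (j + 2) t - j * flat_exp (j + 1) t)) (at t)"
    using greater
    by (intro DERIV_cong[OF DERIV_mult]) (auto simp: flat_exp_def power_add power2_eq_square algebra_simps)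
  then show ?thesis
    by (rule DERIV_cong_ev[THEN iffD1, rotated -1, OF _ refl])
      (use greater in \<open>auto simp: flat_exp_def eventually_nhds intro!: exI[of _ "{0<..}"]\<close>)
next
  case equal
  have "((\<lambda>h. inverse h ^ (j + 1) * exp (- inverse h)) \<longlongrightarrow> 0) (at_right (0::real))"
    using filterlim_compose[OF tendsto_power_div_exp_0[of "j + 1"] filterlim_inverse_at_top_right]
    by (simp add: exp_minus divide_inverse)
  then have r: "((\<lambda>h. (flat_exp j (0 + h) - flat_exp j 0) / h) \<longlongrightarrow> 0) (at_right 0)"
    by (rule tendsto_cong[THEN iffD1, rotated])
      (auto simp: flat_exp_def eventually_at_right_field field_simps intro!: exI[of _ 1])
  have l: "((\<lambda>h. (flat_exp j (0 + h) - flat_exp j 0) / h) \<longlongrightarrow> 0) (at_left 0)"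
    by (rule tendsto_eventually)
      (auto simp: flat_exp_def eventually_at_left_field intro!: exI[of _ "-1"])
  have "(flat_exp j has_field_derivative 0) (at 0)"
    unfolding DERIV_def using l r by (rule filterlim_split_at)
  then show ?thesis using equal by (simp add: flat_exp_def)
qed

lemma smooth_on_flat_exp: "smooth_on UNIV (flat_exp j)"
  unfolding smooth_on_def
proof
  fix k show "Ck_on k UNIV (flat_exp j)"
  proof (induction k arbitrary: j)
    case 0
    then show ?case
      using DERIV_continuous[OF flat_exp_deriv] by (simp add: continuous_on_eq_continuous_at)
  next
    case (Suc k)
    show ?case
    proof (rule Ck_on_SucI)
      show "(flat_exp j has_derivative
          (\<lambda>v. (flat_exp (j + 2) t + (- real j) * flat_exp (j + 1) t) * v)) (at t)" for t
        using flat_exp_deriv[of j t] by (simp add: has_field_derivative_def)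
      show "Ck_on k UNIV (\<lambda>t. (flat_exp (j + 2) t + (- real j) * flat_exp (j + 1) t) * v)" for v
        by (intro Ck_on_mult Ck_on_add Suc Ck_on_const open_UNIV)
    qed simp
  qed
qed

text \<open>The standard quotient \<open>a / (a + b)\<close>, where \<open>a\<close> vanishes outside the ball of radius \<open>2 r\<close> and \<open>b\<close>
vanishes inside the ball of radius \<open>r\<close>.\<close>
lemma exists_bump_function:
  fixes p :: "'a::euclidean_space"
  assumes "r > 0"
  obtains \<rho> :: "'a \<Rightarrow> real" where "smooth_on UNIV \<rho>"
    "\<And>y. dist p y \<le> r \<Longrightarrow> \<rho> y = 1" "\<And>y. dist p y \<ge> 2 * r \<Longrightarrow> \<rho> y = 0"
proof
  define a where "a y = flat_exp 0 (4 * r\<^sup>2 - (y - p) \<bullet> (y - p))" for y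
  define b where "b y = flat_exp 0 ((y - p) \<bullet> (y - p) - r\<^sup>2)" for y
  let ?\<rho> = "\<lambda>y. a y * inverse (a y + b y)"
  have sq: "(y - p) \<bullet> (y - p) = (dist p y)\<^sup>2" for y
    by (metis dist_commute dist_norm power2_norm_eq_inner)
  have pos: "a y + b y > 0" for y
  proof (cases "(dist p y)\<^sup>2 < 4 * r\<^sup>2")
    case True
    then show ?thesis by (simp add: a_def b_def sq flat_exp_pos add_pos_nonneg flat_exp_nonneg)
  next
    case False
    then have "(dist p y)\<^sup>2 - r\<^sup>2 > 0"
      using zero_less_power[OF assms, of 2] by linarith
    then show ?thesis by (simp add: a_def b_def sq flat_exp_pos add_nonneg_pos flat_exp_nonneg)
  qed
  have "smooth_on UNIV a" "smooth_on UNIV b"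
    unfolding a_def b_def
    by (intro smooth_on_compose[OF open_UNIV open_UNIV _ _ smooth_on_flat_exp] subset_UNIV
        smooth_on_diff smooth_on_inner smooth_on_const smooth_on_id open_UNIV)+
  then show "smooth_on UNIV ?\<rho>"
    using pos by (intro smooth_on_mult smooth_on_inverse smooth_on_add open_UNIV)
      (auto simp: less_imp_neq[THEN not_sym])
  show "?\<rho> y = 1" if "dist p y \<le> r" for y
  proof -
    have "b y = 0"
      using power_mono[OF that, of 2] by (simp add: b_def sq flat_exp_def)
    then show ?thesis using pos[of y] by simp
  qed
  show "?\<rho> y = 0" if "dist p y \<ge> 2 * r" for y
    using power_mono[OF that, of 2] assms by (simp add: a_def sq flat_exp_def)
qed

section \<open>Symmetry of second derivatives\<close>

text \<open>The mean value theorem applied once in direction \<open>v\<close> and once in direction \<open>w\<close>. The left-hand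
side is symmetric in \<open>v\<close> and \<open>w\<close>, which is what makes mixed second derivatives agree in the limit.\<close>
lemma second_difference_mvt:
  fixes f :: "'a::real_normed_vector \<Rightarrow> real"
  assumes t: "t > 0"
    and f: "\<And>y. y \<in> S \<Longrightarrow> (f has_derivative D y) (at y)"
    and D: "\<And>y. y \<in> S \<Longrightarrow> ((\<lambda>z. D z v) has_derivative D2 y) (at y)"
    and S: "\<And>s r. 0 \<le> s \<Longrightarrow> s \<le> t \<Longrightarrow> 0 \<le> r \<Longrightarrow> r \<le> t \<Longrightarrow> x + s *\<^sub>R v + r *\<^sub>R w \<in> S"
  obtains s r where "0 \<le> s" "s \<le> t" "0 \<le> r" "r \<le> t"
    "f (x + t *\<^sub>R v + t *\<^sub>R w) - f (x + t *\<^sub>R v) - f (x + t *\<^sub>R w) + f x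
      = t\<^sup>2 * D2 (x + s *\<^sub>R v + r *\<^sub>R w) w"
proof -
  have line: "((\<lambda>s. h (y + s *\<^sub>R u)) has_field_derivative h' u) (at s)"
    if "(h has_derivative h') (at (y + s *\<^sub>R u))" for h :: "'a \<Rightarrow> real" and h' y u s
  proof -
    have "((\<lambda>s. h (y + s *\<^sub>R u)) has_derivative (\<lambda>d. h' (d *\<^sub>R u))) (at s)"
      by (rule has_derivative_compose[where f="\<lambda>s. y + s *\<^sub>R u" and g=h and g'=h', OF _ that])
        (auto intro!: derivative_eq_intros)
    then show ?thesis
      using linear_scale[OF has_derivative_linear[OF that]]
      by (simp add: has_field_derivative_def mult_commute_abs)
  qed
  define \<phi> where "\<phi> s = f ((x + t *\<^sub>R w) + s *\<^sub>R v) - f (x + s *\<^sub>R v)" for s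
  have "(\<phi> has_field_derivative D (x + t *\<^sub>R w + s *\<^sub>R v) v - D (x + s *\<^sub>R v) v) (at s)"
    if "0 \<le> s" "s \<le> t" for s
    unfolding \<phi>_def using S[of s t] S[of s 0] t that
    by (intro DERIV_diff line f) (auto simp: algebra_simps)
  then obtain s where s: "0 < s" "s < t"
    and \<phi>: "\<phi> t - \<phi> 0 = (t - 0) * (D (x + t *\<^sub>R w + s *\<^sub>R v) v - D (x + s *\<^sub>R v) v)"
    using MVT2[OF t, of \<phi> "\<lambda>s. D (x + t *\<^sub>R w + s *\<^sub>R v) v - D (x + s *\<^sub>R v) v"] by blast
  define \<theta> where "\<theta> r = D ((x + s *\<^sub>R v) + r *\<^sub>R w) v" for r
  have "(\<theta> has_field_derivative D2 (x + s *\<^sub>R v + r *\<^sub>R w) w) (at r)" if "0 \<le> r" "r \<le> t" for r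
    unfolding \<theta>_def using S[of s r] s that by (intro line D) auto
  then obtain r where r: "0 < r" "r < t"
    and \<theta>: "\<theta> t - \<theta> 0 = (t - 0) * D2 (x + s *\<^sub>R v + r *\<^sub>R w) w"
    using MVT2[OF t, of \<theta> "\<lambda>r. D2 (x + s *\<^sub>R v + r *\<^sub>R w) w"] by blast
  show thesis
  proof (rule that[of s r])
    have "\<phi> t - \<phi> 0 = t * (\<theta> t - \<theta> 0)"
      unfolding \<phi> \<theta>_def by (simp add: algebra_simps)
    then show "f (x + t *\<^sub>R v + t *\<^sub>R w) - f (x + t *\<^sub>R v) - f (x + t *\<^sub>R w) + f x
      = t\<^sup>2 * D2 (x + s *\<^sub>R v + r *\<^sub>R w) w"
      unfolding \<theta> \<phi>_def by (simp add: algebra_simps power2_eq_square)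
  qed (use s r in auto)
qed

proposition second_derivative_symmetric:
  fixes f :: "'a::real_normed_vector \<Rightarrow> real"
  assumes "open S" "Ck_on 2 S f" "x \<in> S"
  defines "D \<equiv> \<lambda>y. frechet_derivative f (at y)"
  shows "frechet_derivative (\<lambda>y. D y v) (at x) w = frechet_derivative (\<lambda>y. D y w) (at x) v"
proof -
  define D2 where "D2 u y = frechet_derivative (\<lambda>z. D z u) (at y)" for u y
  have C1: "Ck_on 1 S (\<lambda>y. D y u)" for u
    using assms(2) by (simp add: numeral_2_eq_2 D_def)
  have D: "(f has_derivative D y) (at y)" if "y \<in> S" for y
    using Ck_on_Suc_has_derivative[of 1 S f y] assms(2) that by (simp add: D_def numeral_2_eq_2)
  have D2: "((\<lambda>z. D z u) has_derivative D2 u y) (at y)" if "y \<in> S" for y u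
    using Ck_on_Suc_has_derivative[of 0 S _ y] C1[of u] that unfolding D2_def by simp
  have lim: "((\<lambda>y. D2 u y z) \<longlongrightarrow> D2 u x z) (nhds x)" for u z
  proof -
    have "isCont (\<lambda>y. D2 u y z) x"
      using C1[of u] assms(1,3) by (simp add: D2_def continuous_on_eq_continuous_at)
    then show ?thesis
      unfolding isCont_def by (rule tendsto_at_iff_tendsto_nhds[THEN iffD1])
  qed
  have "\<bar>D2 v x w - D2 w x v\<bar> < e" if "e > 0" for e
  proof -
    have "\<forall>\<^sub>F y in nhds x. y \<in> S \<and> dist (D2 v y w) (D2 v x w) < e/2 \<and>
        dist (D2 w y v) (D2 w x v) < e/2"
      using that
      by (intro eventually_conj eventually_nhds_in_open[OF assms(1,3)] tendstoD[OF lim]) simp_all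
    then obtain d where d: "d > 0" and near: "\<And>y. dist y x < d \<Longrightarrow> y \<in> S \<and>
        dist (D2 v y w) (D2 v x w) < e/2 \<and> dist (D2 w y v) (D2 w x v) < e/2"
      unfolding eventually_nhds_metric by blast
    define t where "t = d / (2 * (norm v + norm w + 1))"
    have n: "norm v + norm w + 1 > 0"
      by (smt (verit) norm_ge_zero)
    have t: "t > 0" using d n by (simp add: t_def)
    have close: "dist (x + s *\<^sub>R a + r *\<^sub>R b) x < d"
      if "0 \<le> s" "s \<le> t" "0 \<le> r" "r \<le> t" "norm a + norm b = norm v + norm w" for s r a b
    proof -
      have "dist (x + s *\<^sub>R a + r *\<^sub>R b) x \<le> s * norm a + r * norm b"
        using norm_triangle_ineq[of "s *\<^sub>R a" "r *\<^sub>R b"] that by (simp add: dist_norm)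
      also have "\<dots> \<le> t * (norm a + norm b)"
        unfolding distrib_left using that by (intro add_mono mult_right_mono) simp_all
      also have "\<dots> < t * (2 * (norm v + norm w + 1))"
        using t n that by (intro mult_strict_left_mono) auto
      also have "\<dots> = d" using n by (simp add: t_def)
      finally show ?thesis .
    qed
    obtain s r where sr: "0 \<le> s" "s \<le> t" "0 \<le> r" "r \<le> t"
      "f (x + t *\<^sub>R v + t *\<^sub>R w) - f (x + t *\<^sub>R v) - f (x + t *\<^sub>R w) + f x
        = t\<^sup>2 * D2 v (x + s *\<^sub>R v + r *\<^sub>R w) w"
      by (rule second_difference_mvt[OF t, of S f D v "D2 v" x w]) (use D D2 near close in blast)+
    obtain s' r' where sr': "0 \<le> s'" "s' \<le> t" "0 \<le> r'" "r' \<le> t"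
      "f (x + t *\<^sub>R w + t *\<^sub>R v) - f (x + t *\<^sub>R w) - f (x + t *\<^sub>R v) + f x
        = t\<^sup>2 * D2 w (x + s' *\<^sub>R w + r' *\<^sub>R v) v"
      by (rule second_difference_mvt[OF t, of S f D w "D2 w" x v])
        (use D D2 near close[of _ _ w v] add.commute[of "norm w"] in auto)
    have "t\<^sup>2 * D2 v (x + s *\<^sub>R v + r *\<^sub>R w) w = t\<^sup>2 * D2 w (x + s' *\<^sub>R w + r' *\<^sub>R v) v"
      using sr(5) sr'(5) by (simp add: algebra_simps)
    then have "D2 v (x + s *\<^sub>R v + r *\<^sub>R w) w = D2 w (x + s' *\<^sub>R w + r' *\<^sub>R v) v"
      using t by simp
    moreover have "dist (D2 v (x + s *\<^sub>R v + r *\<^sub>R w) w) (D2 v x w) < e/2"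
      using near close sr by blast
    moreover have "dist (D2 w (x + s' *\<^sub>R w + r' *\<^sub>R v) v) (D2 w x v) < e/2"
      using near close[of s' r' w v] sr' by (simp add: add.commute)
    ultimately show ?thesis
      unfolding dist_real_def by linarith
  qed
  then have "D2 v x w = D2 w x v"
    by (metis abs_ge_zero eq_iff_diff_eq_0 abs_eq_0 less_irrefl order_le_less)
  then show ?thesis by (simp add: D2_def)
qed

section \<open>Chains of linear outputs\<close>

text \<open>The \<open>l\<close>-th chain is \<open>c l, F (c l), \<dots>\<close>, with \<open>\<nu> l\<close> elements. The map \<open>P\<close> kills all of them
but the last, and the images of the last ones are independent. In terms of covectors, with \<open>F\<close> the
transpose of \<open>E\<close> and \<open>P\<close> the transpose of \<open>B\<close>, this says that the outputs \<open>c l\<close> of the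
system \<open>(E, B)\<close> have vector relative degree \<open>\<nu>\<close>.\<close>
definition output_chains ::
    "('a::real_vector \<Rightarrow> 'a) \<Rightarrow> ('a \<Rightarrow> 'b::real_vector) \<Rightarrow> ('m::finite \<Rightarrow> 'a) \<Rightarrow> ('m \<Rightarrow> nat) \<Rightarrow> bool" where
  "output_chains F P c \<nu> \<longleftrightarrow>
     (\<forall>l. 1 \<le> \<nu> l) \<and>
     (\<forall>l q. q + 2 \<le> \<nu> l \<longrightarrow> P ((F ^^ q) (c l)) = 0) \<and>
     (\<forall>b. (\<Sum>l\<in>UNIV. b l *\<^sub>R P ((F ^^ (\<nu> l - 1)) (c l))) = 0 \<longrightarrow> (\<forall>l. b l = 0))"

definition chain_indices :: "('m \<Rightarrow> nat) \<Rightarrow> ('m \<times> nat) set" where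
  "chain_indices \<nu> = (SIGMA l:UNIV. {..<\<nu> l})"

lemma finite_chain_indices [simp]: "finite (chain_indices (\<nu> :: 'm::finite \<Rightarrow> nat))"
  by (simp add: chain_indices_def)

lemma card_chain_indices: "card (chain_indices (\<nu> :: 'm::finite \<Rightarrow> nat)) = (\<Sum>l\<in>UNIV. \<nu> l)"
  by (simp add: chain_indices_def)

lemma linear_funpow: "linear (F :: 'a::real_vector \<Rightarrow> 'a) \<Longrightarrow> linear (F ^^ k)"
  by (induction k) (auto simp: linear_iff)

text \<open>Coefficients are shown to vanish by induction on their distance \<open>d\<close> from the end of the chain.
When \<open>P \<circ> F\<^sup>d\<close> is applied to the relation, elements farther than \<open>d\<close> from the end are killed, those
nearer to the end have coefficient zero by induction, and the elements at distance exactly \<open>d\<close> are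
mapped to the independent vectors at the ends of the chains.\<close>
lemma output_chains_coeff_zero:
  assumes "linear F" "linear P" and ch: "output_chains F P c \<nu>"
    and sum0: "(\<Sum>(l, k)\<in>chain_indices \<nu>. a l k *\<^sub>R (F ^^ k) (c l)) = 0"
    and "k < \<nu> l"
  shows "a l k = 0"
proof -
  have \<nu>1: "1 \<le> \<nu> l" and low: "q + 2 \<le> \<nu> l \<Longrightarrow> P ((F ^^ q) (c l)) = 0" for l q
    using ch by (auto simp: output_chains_def)
  have "d < \<nu> l \<Longrightarrow> a l (\<nu> l - 1 - d) = 0" for d l
  proof (induction d arbitrary: l rule: less_induct)
    case (less d)
    have above: "a l k = 0" if "k < \<nu> l" "\<nu> l \<le> k + d" for l k
      using less.IH[of "\<nu> l - 1 - k" l] that by simp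
    interpret PF: linear "\<lambda>x. P ((F ^^ d) x)"
      using linear_compose[OF linear_funpow[OF assms(1)] assms(2)] by (simp add: o_def)
    define b where "b l = (if d < \<nu> l then a l (\<nu> l - 1 - d) else 0)" for l
    have inner: "(\<Sum>k<\<nu> l. a l k *\<^sub>R P ((F ^^ (d + k)) (c l))) = b l *\<^sub>R P ((F ^^ (\<nu> l - 1)) (c l))" for l
    proof (cases "d < \<nu> l")
      case True
      have "a l k *\<^sub>R P ((F ^^ (d + k)) (c l)) = 0" if "k < \<nu> l" "k \<noteq> \<nu> l - 1 - d" for k
        using that above[of k l] low[of "d + k" l] by (cases "\<nu> l \<le> k + d") auto
      then have "(\<Sum>k<\<nu> l. a l k *\<^sub>R P ((F ^^ (d + k)) (c l))) =
          (\<Sum>k\<in>{\<nu> l - 1 - d}. a l k *\<^sub>R P ((F ^^ (d + k)) (c l)))"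
        using True by (intro sum.mono_neutral_right) auto
      then show ?thesis using True by (simp add: b_def)
    next
      case False
      then show ?thesis using above by (simp add: b_def)
    qed
    have "0 = P ((F ^^ d) (\<Sum>(l, k)\<in>chain_indices \<nu>. a l k *\<^sub>R (F ^^ k) (c l)))"
      using PF.zero by (simp add: sum0)
    also have "\<dots> = (\<Sum>(l, k)\<in>chain_indices \<nu>. a l k *\<^sub>R P ((F ^^ (d + k)) (c l)))"
      by (simp add: PF.sum PF.scale case_prod_unfold funpow_add)
    also have "\<dots> = (\<Sum>l\<in>UNIV. \<Sum>k<\<nu> l. a l k *\<^sub>R P ((F ^^ (d + k)) (c l)))"
      by (simp add: chain_indices_def sum.Sigma)
    also have "\<dots> = (\<Sum>l\<in>UNIV. b l *\<^sub>R P ((F ^^ (\<nu> l - 1)) (c l)))"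
      by (simp add: inner)
    finally have "b l = 0"
      using ch unfolding output_chains_def by metis
    then show ?case
      using less.prems by (simp add: b_def)
  qed
  from this[of "\<nu> l - 1 - k" l] show ?thesis
    using assms(5) by simp
qed

proposition output_chains_independent:
  assumes "linear F" "linear P" "output_chains F P c \<nu>"
  defines "el \<equiv> \<lambda>(l, k). (F ^^ k) (c l)"
  shows "inj_on el (chain_indices \<nu>)" "independent (el ` chain_indices \<nu>)"
proof -
  have el: "el i = (F ^^ snd i) (c (fst i))" for i
    by (simp add: el_def case_prod_unfold)
  have zero: "u i = 0" if "(\<Sum>i\<in>chain_indices \<nu>. u i *\<^sub>R el i) = 0" "i \<in> chain_indices \<nu>" for u i
    using output_chains_coeff_zero[OF assms(1-3), of "\<lambda>l k. u (l, k)" "snd i" "fst i"] that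
    by (auto simp: el_def case_prod_unfold chain_indices_def)
  show inj: "inj_on el (chain_indices \<nu>)"
  proof (rule inj_onI, rule ccontr)
    fix i j assume ij: "i \<in> chain_indices \<nu>" "j \<in> chain_indices \<nu>" "el i = el j" "i \<noteq> j"
    define u :: "_ \<Rightarrow> real" where "u = (\<lambda>x. if x = i then 1 else if x = j then -1 else 0)"
    have "(\<Sum>x\<in>chain_indices \<nu>. u x *\<^sub>R el x) = (\<Sum>x\<in>{i, j}. u x *\<^sub>R el x)"
      using ij by (intro sum.mono_neutral_right) (auto simp: u_def)
    also have "\<dots> = 0" using ij by (simp add: u_def)
    finally have "u i = 0" using ij zero by blast
    then show False by (simp add: u_def)
  qed
  show "independent (el ` chain_indices \<nu>)"
  proof (rule independent_if_scalars_zero)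
    fix u x assume s: "(\<Sum>x\<in>el ` chain_indices \<nu>. u x *\<^sub>R x) = 0" "x \<in> el ` chain_indices \<nu>"
    then obtain i where "i \<in> chain_indices \<nu>" "x = el i" by blast
    then show "u x = 0"
      using s(1) zero[of "\<lambda>i. u (el i)" i] by (simp add: sum.reindex[OF inj])
  qed simp
qed

lemma output_chains_sum_le:
  fixes F :: "'a::euclidean_space \<Rightarrow> 'a"
  assumes "linear F" "linear P" "output_chains F P c \<nu>"
  shows "(\<Sum>l\<in>UNIV. \<nu> l) \<le> DIM('a)"
  using output_chains_independent[OF assms] independent_bound card_chain_indices[of \<nu>] card_image
  by metis

lemma output_chains_leading_surj:
  fixes P :: "'a::real_vector \<Rightarrow> real^'m" and c :: "'m \<Rightarrow> 'a"
  assumes "output_chains F P c \<nu>"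
  obtains a where "y = (\<Sum>l\<in>UNIV. a l *\<^sub>R P ((F ^^ (\<nu> l - 1)) (c l)))"
proof -
  define T where "T b = (\<Sum>l\<in>UNIV. (b $ l) *\<^sub>R P ((F ^^ (\<nu> l - 1)) (c l)))" for b :: "real^'m"
  have lin: "linear T"
    by (rule linearI) (simp_all add: T_def scaleR_left_distrib sum.distrib scaleR_right.sum)
  have "inj T"
    unfolding linear_injective_0[OF lin] using assms by (auto simp: T_def output_chains_def vec_eq_iff)
  then have "surj T"
    by (rule linear_injective_imp_surjective[OF lin _ refl])
  then obtain b where "y = T b" by blast
  then show thesis using that unfolding T_def by blast
qed

text \<open>Here \<open>obs\<close> is observability, dual to controllability. Among all families of chains, choose one of
maximal total length; it exists because chains are independent. If its span \<open>W\<close> were not the whole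
space, there would be, for every \<open>k\<close>, a vector outside \<open>W\<close> that is killed by \<open>P \<circ> F\<^sup>q\<close> for all
\<open>q < k\<close>, against observability. In the step from \<open>k\<close> to \<open>k + 1\<close>, expand \<open>P (F\<^sup>k x)\<close> in the
independent end vectors. If a chain of length at most \<open>k\<close> took part, the longer chain started by
\<open>x\<close> could replace it. So all participating chains are longer than \<open>k\<close>, and subtracting suitable
elements of them from \<open>x\<close> makes \<open>P (F\<^sup>k x)\<close> vanish.\<close>
proposition exists_output_chains_basis:
  fixes F :: "'a::euclidean_space \<Rightarrow> 'a" and P :: "'a \<Rightarrow> real^'m"
  assumes F: "linear F" and P: "linear P" and surj: "surj P"
    and obs: "\<And>x. (\<And>q. q < N \<Longrightarrow> P ((F ^^ q) x) = 0) \<Longrightarrow> x = 0"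
  obtains c :: "'m \<Rightarrow> 'a" and \<nu> where "output_chains F P c \<nu>" "(\<Sum>l\<in>UNIV. \<nu> l) = DIM('a)"
proof -
  define good where "good p \<longleftrightarrow> output_chains F P (fst p) (snd p)"
    for p :: "('m \<Rightarrow> 'a) \<times> ('m \<Rightarrow> nat)"
  define wt where "wt p = (\<Sum>l\<in>UNIV. snd p l)" for p :: "('m \<Rightarrow> 'a) \<times> ('m \<Rightarrow> nat)"
  define c0 :: "'m \<Rightarrow> 'a" where "c0 l = inv P (axis l 1)" for l
  have c0: "P (c0 l) = axis l 1" for l
    by (simp add: c0_def surj_f_inv_f[OF surj])
  have "(\<Sum>l\<in>UNIV. b l *\<^sub>R axis l 1) $ j = b j" for b and j :: 'm
    by (simp add: axis_def if_distrib cong: if_cong)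
  then have "good (c0, \<lambda>_. 1)"
    by (auto simp: good_def output_chains_def c0 vec_eq_iff)
  moreover have "wt p \<le> DIM('a)" if "good p" for p
    using output_chains_sum_le[OF F P] that by (auto simp: good_def wt_def)
  ultimately obtain p where "good p" and max: "\<And>q. good q \<Longrightarrow> wt q \<le> wt p"
    using ex_has_greatest_nat[of good _ wt] by (metis le_imp_less_Suc less_imp_le_nat)
  obtain c \<nu> where p: "p = (c, \<nu>)" by (cases p)
  have ch: "output_chains F P c \<nu>"
    using \<open>good p\<close> by (simp add: p good_def)
  then have \<nu>1: "1 \<le> \<nu> l" and low: "q + 2 \<le> \<nu> l \<Longrightarrow> P ((F ^^ q) (c l)) = 0"
    and ind: "(\<Sum>l\<in>UNIV. b l *\<^sub>R P ((F ^^ (\<nu> l - 1)) (c l))) = 0 \<Longrightarrow> b l = 0" for l q b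
    by (auto simp: output_chains_def)
  define el where "el = (\<lambda>(l, k). (F ^^ k) (c l))"
  define W where "W = span (el ` chain_indices \<nu>)"
  have chain_W: "(F ^^ k) (c l) \<in> W" if "k < \<nu> l" for k l
    using that unfolding W_def el_def
    by (intro span_base image_eqI[of _ _ "(l, k)"]) (auto simp: chain_indices_def)
  have PF: "linear (\<lambda>x. P ((F ^^ q) x))" for q
    using linear_compose[OF linear_funpow[OF F] P] by (simp add: o_def)
  have step: "\<exists>x. x \<notin> W \<and> (\<forall>q<k. P ((F ^^ q) x) = 0)" if "UNIV \<noteq> W" for k
  proof (induction k)
    case 0
    then show ?case using that by auto
  next
    case (Suc k)
    then obtain x where x: "x \<notin> W" "\<And>q. q < k \<Longrightarrow> P ((F ^^ q) x) = 0" by blast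
    obtain a where a: "P ((F ^^ k) x) = (\<Sum>l\<in>UNIV. a l *\<^sub>R P ((F ^^ (\<nu> l - 1)) (c l)))"
      using output_chains_leading_surj[OF ch] by blast
    have long: "k < \<nu> l" if "a l \<noteq> 0" for l
    proof (rule ccontr)
      assume "\<not> k < \<nu> l"
      \<comment> \<open>Replacing the chain \<open>l\<close> by the longer one that starts at \<open>x\<close> contradicts maximality.\<close>
      define c' where "c' = c(l := x)"
      define \<nu>' where "\<nu>' = \<nu>(l := k + 1)"
      have "output_chains F P c' \<nu>'"
        unfolding output_chains_def
      proof (intro conjI allI impI)
        show "1 \<le> \<nu>' j" for j using \<nu>1 by (simp add: \<nu>'_def)
        show "P ((F ^^ q) (c' j)) = 0" if "q + 2 \<le> \<nu>' j" for j q
          using that low x(2) by (auto simp: c'_def \<nu>'_def split: if_splits)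
        fix b j assume "(\<Sum>i\<in>UNIV. b i *\<^sub>R P ((F ^^ (\<nu>' i - 1)) (c' i))) = 0"
        moreover have "(\<Sum>i\<in>UNIV. b i *\<^sub>R P ((F ^^ (\<nu>' i - 1)) (c' i))) =
            (\<Sum>i\<in>UNIV. (if i = l then b l *\<^sub>R P ((F ^^ k) x) else 0) +
              (if i = l then 0 else b i) *\<^sub>R P ((F ^^ (\<nu> i - 1)) (c i)))"
          by (intro sum.cong) (auto simp: c'_def \<nu>'_def)
        moreover have "\<dots> = (\<Sum>i\<in>UNIV. (b l * a i + (if i = l then 0 else b i))
            *\<^sub>R P ((F ^^ (\<nu> i - 1)) (c i)))"
          by (simp add: sum.distrib a scaleR_right.sum scaleR_left_distrib)
        ultimately have z: "b l * a i + (if i = l then 0 else b i) = 0" for i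
          using ind[of "\<lambda>i. b l * a i + (if i = l then 0 else b i)" i] by simp
        have "b l = 0" using z[of l] \<open>a l \<noteq> 0\<close> by simp
        then show "b j = 0" using z[of j] by (simp split: if_splits)
      qed
      then have "wt (c', \<nu>') \<le> wt p" using max by (simp add: good_def)
      moreover have "wt (c', \<nu>') > wt p"
        unfolding wt_def p using \<open>\<not> k < \<nu> l\<close>
        by (intro sum_strict_mono_ex1) (auto simp: \<nu>'_def intro!: exI[of _ l])
      ultimately show False by simp
    qed
    \<comment> \<open>The exponent is chosen so that applying \<open>F\<^sup>k\<close> leads to the end of each chain.\<close>
    define y where "y = (\<Sum>l\<in>UNIV. a l *\<^sub>R (F ^^ (\<nu> l - 1 - k)) (c l))"
    have "y \<in> W"
      unfolding y_def W_def
    proof (rule span_sum)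
      fix l show "a l *\<^sub>R (F ^^ (\<nu> l - 1 - k)) (c l) \<in> span (el ` chain_indices \<nu>)"
        using chain_W[of "\<nu> l - 1 - k" l] \<nu>1[of l] unfolding W_def by (intro span_scale) simp
    qed
    then have "x - y \<notin> W"
      using x(1) unfolding W_def by (metis diff_add_cancel span_add)
    moreover have "P ((F ^^ q) (x - y)) = 0" if "q < Suc k" for q
    proof -
      have Py: "P ((F ^^ q) y) = (\<Sum>l\<in>UNIV. a l *\<^sub>R P ((F ^^ (q + (\<nu> l - 1 - k))) (c l)))"
        unfolding y_def by (simp add: linear_sum[OF PF] linear_scale[OF PF] funpow_add)
      have "P ((F ^^ q) y) = P ((F ^^ q) x)"
      proof (cases "q = k")
        case True
        then show ?thesis
          unfolding True Py[unfolded True] a using long by (intro sum.cong) force+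
      next
        case False
        then have "a l *\<^sub>R P ((F ^^ (q + (\<nu> l - 1 - k))) (c l)) = 0" for l
          using long[of l] low[of "q + (\<nu> l - 1 - k)" l] that by (cases "a l = 0") auto
        then have "P ((F ^^ q) y) = 0"
          unfolding Py by (intro sum.neutral) blast
        then show ?thesis using x(2)[of q] that False by simp
      qed
      then show ?thesis by (simp add: linear_diff[OF PF])
    qed
    ultimately show ?case by blast
  qed
  have "0 \<in> W" by (simp add: W_def span_zero)
  then have "UNIV = W"
    using step[of N] obs by metis
  then have "DIM('a) \<le> card (el ` chain_indices \<nu>)"
    unfolding W_def by (metis dim_UNIV dim_le_card' dim_span finite_chain_indices finite_imageI)
  also have "\<dots> \<le> (\<Sum>l\<in>UNIV. \<nu> l)"
    using card_image_le[of "chain_indices \<nu>" el] by (simp add: card_chain_indices)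
  finally show thesis
    using that[OF ch] output_chains_sum_le[OF F P ch] by simp
qed

section \<open>Derivatives with varying direction\<close>

lemma linear_axis_expansion:
  fixes L :: "real^'n \<Rightarrow> 'b::real_vector"
  assumes "linear L"
  shows "L v = (\<Sum>k\<in>UNIV. (v $ k) *\<^sub>R L (axis k 1))"
proof -
  have "v = (\<Sum>k\<in>UNIV. (v $ k) *\<^sub>R axis k 1)"
    using basis_expansion[of v] by (simp add: scalar_mult_eq_scaleR)
  then show ?thesis
    by (metis (no_types, lifting) assms linear_scale linear_sum sum.cong)
qed

lemma frechet_derivative_axis_expansion:
  fixes f :: "real^'n \<Rightarrow> 'b::real_normed_vector"
  assumes "smooth_on S f" "x \<in> S"
  shows "frechet_derivative f (at x) v =
    (\<Sum>k\<in>UNIV. (v $ k) *\<^sub>R frechet_derivative f (at x) (axis k 1))"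
  using smooth_on_has_derivative[OF assms] has_derivative_linear linear_axis_expansion by blast

lemma second_derivative_axis_expansion:
  fixes f :: "real^'n \<Rightarrow> 'b::real_normed_vector"
  assumes "open S" "smooth_on S f" "x \<in> S"
  shows "frechet_derivative (\<lambda>y. frechet_derivative f (at y) v) (at x) w =
    (\<Sum>k\<in>UNIV. (v $ k) *\<^sub>R
      frechet_derivative (\<lambda>y. frechet_derivative f (at y) (axis k 1)) (at x) w)"
proof -
  let ?s = "\<lambda>y. \<Sum>k\<in>UNIV. (v $ k) *\<^sub>R frechet_derivative f (at y) (axis k 1)"
  have H: "(?s has_derivative (\<lambda>w. \<Sum>k\<in>UNIV. (v $ k) *\<^sub>R
      frechet_derivative (\<lambda>y. frechet_derivative f (at y) (axis k 1)) (at x) w)) (at x)"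
    using smooth_on_has_derivative[OF smooth_on_frechet_derivative[OF assms(2)] assms(3)]
    by (intro has_derivative_sum has_derivative_scaleR_right)
  have E: "frechet_derivative (\<lambda>y. frechet_derivative f (at y) v) (at x) =
      frechet_derivative ?s (at x)"
    by (rule frechet_derivative_cong_open[OF assms(1,3)])
      (rule frechet_derivative_axis_expansion[OF assms(2)])
  show ?thesis
    by (simp only: E frechet_derivative_at[OF H, symmetric])
qed

text \<open>The product rule for a derivative taken in a moving direction at a moving point. It yields both
the derivative of a Lie derivative (\<open>p\<close> the identity, \<open>X\<close> the vector field) and that of a tangent
map (\<open>p\<close> and \<open>X\<close> the two projections).\<close>
proposition has_derivative_frechet_apply:
  fixes f :: "real^'n \<Rightarrow> 'b::real_normed_vector" and p X :: "'c::real_normed_vector \<Rightarrow> real^'n"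
  assumes "open S" "smooth_on S f" "p z \<in> S"
    and p: "(p has_derivative p') (at z)" and X: "(X has_derivative X') (at z)"
  shows "((\<lambda>z. frechet_derivative f (at (p z)) (X z)) has_derivative
    (\<lambda>h. frechet_derivative (\<lambda>y. frechet_derivative f (at y) (X z)) (at (p z)) (p' h)
       + frechet_derivative f (at (p z)) (X' h))) (at z)"
proof -
  define D where "D k y = frechet_derivative f (at y) (axis k 1)" for k y
  have D: "((\<lambda>z. D k (p z)) has_derivative (\<lambda>h. frechet_derivative (D k) (at (p z)) (p' h))) (at z)"
    for k
    using smooth_on_has_derivative[OF smooth_on_frechet_derivative[OF assms(2)] assms(3)]
    unfolding D_def by (rule has_derivative_compose[OF p])
  have "((\<lambda>z. \<Sum>k\<in>UNIV. (X z $ k) *\<^sub>R D k (p z)) has_derivative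
     (\<lambda>h. \<Sum>k\<in>UNIV. (X z $ k) *\<^sub>R frechet_derivative (D k) (at (p z)) (p' h)
        + (X' h $ k) *\<^sub>R D k (p z))) (at z)"
    by (intro has_derivative_sum has_derivative_scaleR D
        bounded_linear.has_derivative[OF bounded_linear_vec_nth X])
  moreover have "(\<lambda>h. \<Sum>k\<in>UNIV. (X z $ k) *\<^sub>R frechet_derivative (D k) (at (p z)) (p' h)
        + (X' h $ k) *\<^sub>R D k (p z)) =
     (\<lambda>h. frechet_derivative (\<lambda>y. frechet_derivative f (at y) (X z)) (at (p z)) (p' h)
       + frechet_derivative f (at (p z)) (X' h))"
  proof
    fix h
    show "(\<Sum>k\<in>UNIV. (X z $ k) *\<^sub>R frechet_derivative (D k) (at (p z)) (p' h)
        + (X' h $ k) *\<^sub>R D k (p z)) =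
     frechet_derivative (\<lambda>y. frechet_derivative f (at y) (X z)) (at (p z)) (p' h)
       + frechet_derivative f (at (p z)) (X' h)"
      unfolding second_derivative_axis_expansion[OF assms(1-3), of "X z" "p' h"]
        frechet_derivative_axis_expansion[OF assms(2,3), of "X' h"] D_def[abs_def] sum.distrib ..
  qed
  moreover have "\<forall>\<^sub>F z in at z. (\<Sum>k\<in>UNIV. (X z $ k) *\<^sub>R D k (p z)) =
      frechet_derivative f (at (p z)) (X z)"
  proof -
    have "(p \<longlongrightarrow> p z) (at z)"
      using has_derivative_continuous[OF p] by (simp add: isCont_def)
    then have "\<forall>\<^sub>F z in at z. p z \<in> S"
      using assms(1,3) by (rule topological_tendstoD)
    then show ?thesis
      by (rule eventually_mono)
        (simp add: D_def frechet_derivative_axis_expansion[OF assms(2), symmetric])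
  qed
  moreover have "(\<Sum>k\<in>UNIV. (X z $ k) *\<^sub>R D k (p z)) = frechet_derivative f (at (p z)) (X z)"
    by (simp add: D_def frechet_derivative_axis_expansion[OF assms(2,3), symmetric])
  ultimately show ?thesis
    by (simp add: has_derivative_transform_eventually)
qed

lemma frechet_derivative_bounded_linear:
  assumes "bounded_linear L" "f differentiable (at x)"
  shows "frechet_derivative (\<lambda>y. L (f y)) (at x) v = L (frechet_derivative f (at x) v)"
  using frechet_derivative_at[OF bounded_linear.has_derivative[OF assms(1)
        frechet_derivative_works[THEN iffD1, OF assms(2)]]] by metis

lemma smooth_on_differentiable: "smooth_on S f \<Longrightarrow> x \<in> S \<Longrightarrow> f differentiable (at x)"
  using smooth_on_has_derivative differentiableI by blast

lemma second_derivative_bounded_linear: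
  assumes "open S" "smooth_on S f" "x \<in> S" "bounded_linear L"
  shows "frechet_derivative (\<lambda>y. frechet_derivative (\<lambda>y. L (f y)) (at y) v) (at x) w =
    L (frechet_derivative (\<lambda>y. frechet_derivative f (at y) v) (at x) w)"
proof -
  have "frechet_derivative (\<lambda>y. frechet_derivative (\<lambda>y. L (f y)) (at y) v) (at x) =
      frechet_derivative (\<lambda>y. L (frechet_derivative f (at y) v)) (at x)"
    by (rule frechet_derivative_cong_open[OF assms(1,3)])
      (rule frechet_derivative_bounded_linear[OF assms(4) smooth_on_differentiable[OF assms(2)]])
  then show ?thesis
    using frechet_derivative_bounded_linear[OF assms(4)
        smooth_on_differentiable[OF smooth_on_frechet_derivative[OF assms(2)] assms(3)]] by metis
qed

section \<open>Lie derivatives and the covariant differential\<close>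

lemma lie_cong_open:
  "open S \<Longrightarrow> x \<in> S \<Longrightarrow> (\<And>y. y \<in> S \<Longrightarrow> f y = f' y) \<Longrightarrow> lie X f x = lie X f' x"
  by (simp add: lie_def frechet_derivative_cong_open[of S x f f'])

lemma lie_funpow_cong_open:
  assumes "open S" "\<And>y. y \<in> S \<Longrightarrow> f y = f' y"
  shows "x \<in> S \<Longrightarrow> (lie X ^^ k) f x = (lie X ^^ k) f' x"
proof (induction k arbitrary: x)
  case (Suc k)
  show ?case
    using lie_cong_open[OF assms(1) Suc.prems Suc.IH] by simp
qed (simp add: assms)

lemma partial_cong_open:
  "open S \<Longrightarrow> x \<in> S \<Longrightarrow> (\<And>y. y \<in> S \<Longrightarrow> f y = f' y) \<Longrightarrow> partial j f x = partial j f' x"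
  by (simp add: partial_def frechet_derivative_cong_open[of S x f f'])

lemma nabla_d_cong_open:
  assumes "open S" "x \<in> S" "\<And>y. y \<in> S \<Longrightarrow> f y = f' y"
  shows "nabla_d \<Gamma> f x = nabla_d \<Gamma> f' x"
proof -
  have "partial k f y = partial k f' y" if "y \<in> S" for k y
    using partial_cong_open[OF assms(1) that assms(3)] .
  then have "partial j (partial k f) x = partial j (partial k f') x" for j k
    by (rule partial_cong_open[OF assms(1,2)])
  then show ?thesis
    using partial_cong_open[OF assms] by (simp add: nabla_d_def)
qed

lemma smooth_on_partial: "smooth_on S f \<Longrightarrow> smooth_on S (partial j f)"
  using smooth_on_frechet_derivative by (simp add: partial_def[abs_def])

lemma smooth_on_lie:
  assumes "open S" "smooth_on S X" "smooth_on S f"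
  shows "smooth_on S (lie X f)"
proof (rule smooth_on_cong[OF assms(1)])
  show "(\<Sum>k\<in>UNIV. (X x $ k) *\<^sub>R frechet_derivative f (at x) (axis k 1)) = lie X f x"
    if "x \<in> S" for x
    using frechet_derivative_axis_expansion[OF assms(3) that, of "X x"] by (simp add: lie_def)
  show "smooth_on S (\<lambda>x. \<Sum>k\<in>UNIV. (X x $ k) *\<^sub>R frechet_derivative f (at x) (axis k 1))"
    by (rule smooth_on_sum[OF assms(1)])
      (intro smooth_on_scaleR smooth_on_vec_nth smooth_on_frechet_derivative assms)
qed

lemma smooth_on_lie_funpow:
  "open S \<Longrightarrow> smooth_on S X \<Longrightarrow> smooth_on S f \<Longrightarrow> smooth_on S ((lie X ^^ k) f)"
  by (induction k) (auto intro: smooth_on_lie)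

text \<open>Combined with \<open>nabla_d_apply\<close> this is \<open>d(L\<^sub>X f)(w) = (\<nabla>df)(w,X) + df(\<nabla>\<^sub>w X)\<close>.\<close>
lemma frechet_derivative_lie:
  assumes "open S" "smooth_on S f" "smooth_on S X" "x \<in> S"
  shows "frechet_derivative (lie X f) (at x) w =
    frechet_derivative (\<lambda>y. frechet_derivative f (at y) (X x)) (at x) w
    + frechet_derivative f (at x) (frechet_derivative X (at x) w)"
proof -
  have "(lie X f has_derivative (\<lambda>w.
    frechet_derivative (\<lambda>y. frechet_derivative f (at y) (X x)) (at x) w
    + frechet_derivative f (at x) (frechet_derivative X (at x) w))) (at x)"
    unfolding lie_def[abs_def]
    using has_derivative_frechet_apply[OF assms(1,2), where p="\<lambda>y. y" and p'="\<lambda>h. h",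
        OF assms(4) has_derivative_ident smooth_on_has_derivative[OF assms(3,4)]] .
  from frechet_derivative_at[OF this, symmetric] show ?thesis
    by (rule fun_cong)
qed

lemma nabla_d_apply:
  assumes "open S" "smooth_on S f" "x \<in> S"
  shows "w \<bullet> (nabla_d \<Gamma> f x *v v) =
    frechet_derivative (\<lambda>y. frechet_derivative f (at y) v) (at x) w
    - frechet_derivative f (at x) (quad (\<Gamma> x) w v)"
proof -
  have H: "frechet_derivative (\<lambda>y. frechet_derivative f (at y) v) (at x) w =
      (\<Sum>j\<in>UNIV. \<Sum>k\<in>UNIV. w $ j * (v $ k * partial j (partial k f) x))"
    unfolding second_derivative_axis_expansion[OF assms, of v w]
      frechet_derivative_axis_expansion[OF smooth_on_frechet_derivative[OF assms(2)] assms(3), of _ w]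
    by (subst sum.swap) (simp add: partial_def[abs_def] sum_distrib_left mult_ac)
  have "frechet_derivative f (at x) (quad (\<Gamma> x) w v) =
      (\<Sum>i\<in>UNIV. \<Sum>j\<in>UNIV. \<Sum>k\<in>UNIV. w $ j * (v $ k * (\<Gamma> x $ i $ j $ k * partial i f x)))"
    unfolding frechet_derivative_axis_expansion[OF assms(2,3), of "quad _ _ _"]
    by (simp add: quad_def inner_vec_def matrix_vector_mult_def partial_def
        sum_distrib_left sum_distrib_right mult_ac)
  also have "\<dots> = (\<Sum>j\<in>UNIV. \<Sum>k\<in>UNIV. w $ j * (v $ k * (\<Sum>i\<in>UNIV. \<Gamma> x $ i $ j $ k * partial i f x)))"
    by (subst sum.swap, rule sum.cong[OF refl], subst sum.swap) (simp add: sum_distrib_left)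
  finally show ?thesis
    unfolding H
    by (simp add: nabla_d_def inner_vec_def matrix_vector_mult_def sum_distrib_left
        sum_subtractf[symmetric] algebra_simps)
qed

lemma tangent_map_apply: "tangent_map \<psi> (x, v) = (\<psi> x, frechet_derivative \<psi> (at x) v)"
  by (simp add: tangent_map_def)

lemma frechet_derivative_tangent_map:
  fixes \<psi> :: "real^'n \<Rightarrow> real^'n"
  assumes "open S" "smooth_on S \<psi>" "x \<in> S"
  shows "frechet_derivative (tangent_map \<psi>) (at (x, v)) (a, b) =
    (frechet_derivative \<psi> (at x) a,
     frechet_derivative (\<lambda>y. frechet_derivative \<psi> (at y) v) (at x) a
       + frechet_derivative \<psi> (at x) b)"
proof -
  have "((\<lambda>z. (\<psi> (fst z), frechet_derivative \<psi> (at (fst z)) (snd z))) has_derivative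
    (\<lambda>h. (frechet_derivative \<psi> (at (fst (x, v))) (fst h),
      frechet_derivative (\<lambda>y. frechet_derivative \<psi> (at y) (snd (x, v))) (at (fst (x, v))) (fst h)
       + frechet_derivative \<psi> (at (fst (x, v))) (snd h)))) (at (x, v))"
    using assms
    by (intro has_derivative_Pair has_derivative_frechet_apply[OF assms(1,2)]
        has_derivative_compose[OF _ smooth_on_has_derivative[OF assms(2)]]
        bounded_linear.has_derivative[OF bounded_linear_fst has_derivative_ident]
        bounded_linear.has_derivative[OF bounded_linear_snd has_derivative_ident]) simp_all
  moreover have "tangent_map \<psi> = (\<lambda>z. (\<psi> (fst z), frechet_derivative \<psi> (at (fst z)) (snd z)))"
    by (auto simp: tangent_map_def)
  ultimately have "(tangent_map \<psi> has_derivative (\<lambda>h. (frechet_derivative \<psi> (at x) (fst h),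
      frechet_derivative (\<lambda>y. frechet_derivative \<psi> (at y) v) (at x) (fst h)
       + frechet_derivative \<psi> (at x) (snd h)))) (at (x, v))"
    by simp
  from fun_cong[OF frechet_derivative_at[OF this, symmetric], of "(a, b)"] show ?thesis
    by simp
qed

section \<open>Chains of integrators\<close>

text \<open>A bijection \<open>\<sigma>\<close> from the coordinates to the pairs (chain, position) places the Brunovsky normal
form on \<open>real^'n\<close>: the coordinate at position \<open>k\<close> of a chain is driven by the one at position
\<open>k + 1\<close>, and the last one by the control of that chain.\<close>
definition chain_shift :: "('n::finite \<Rightarrow> 'm \<times> nat) \<Rightarrow> real^'n^'n" where
  "chain_shift \<sigma> =
     (\<chi> i j. if fst (\<sigma> j) = fst (\<sigma> i) \<and> snd (\<sigma> j) = Suc (snd (\<sigma> i)) then 1 else 0)"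

definition chain_input :: "('m::finite \<Rightarrow> nat) \<Rightarrow> ('n::finite \<Rightarrow> 'm \<times> nat) \<Rightarrow> real^'m^'n" where
  "chain_input \<nu> \<sigma> = (\<chi> i l. if fst (\<sigma> i) = l \<and> Suc (snd (\<sigma> i)) = \<nu> l then 1 else 0)"

lemma chain_input_apply:
  assumes "\<sigma> i = (l, k)"
  shows "(chain_input \<nu> \<sigma> *v w) $ i = (if Suc k = \<nu> l then w $ l else 0)"
proof -
  have "(chain_input \<nu> \<sigma> *v w) $ i =
      (\<Sum>j\<in>UNIV. if j = l then (if Suc k = \<nu> l then w $ l else 0) else 0)"
    unfolding chain_input_def matrix_vector_mult_def vec_lambda_beta
    by (rule sum.cong[OF refl]) (auto simp: assms)
  then show ?thesis by simp
qed

lemma chain_shift_apply: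
  assumes "inj \<sigma>" "\<sigma> i = (l, k)" "\<sigma> j = (l, Suc k)"
  shows "(chain_shift \<sigma> *v y) $ i = y $ j"
proof -
  have "(fst (\<sigma> j') = l \<and> snd (\<sigma> j') = Suc k) \<longleftrightarrow> j' = j" for j'
    using assms by (metis fst_conv injD prod.collapse snd_conv)
  then have "(chain_shift \<sigma> *v y) $ i = (\<Sum>j'\<in>UNIV. if j' = j then y $ j else 0)"
    unfolding chain_shift_def matrix_vector_mult_def vec_lambda_beta
    by (intro sum.cong[OF refl]) (simp add: assms(2))
  then show ?thesis by simp
qed

lemma chain_shift_apply_last:
  assumes "range \<sigma> = chain_indices \<nu>" "\<sigma> i = (l, k)" "Suc k = \<nu> l"
  shows "(chain_shift \<sigma> *v y) $ i = 0"
proof -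
  have "\<not> (fst (\<sigma> j) = l \<and> snd (\<sigma> j) = Suc k)" for j
    using rangeI[of \<sigma> j] assms(1,3) by (auto simp: chain_indices_def)
  then show ?thesis
    unfolding chain_shift_def matrix_vector_mult_def vec_lambda_beta
    using assms(2) by (intro sum.neutral) auto
qed

lemma chain_shift_axis:
  assumes "inj \<sigma>" "\<sigma> i = (l, k)" "\<sigma> j = (l, Suc k)"
  shows "chain_shift \<sigma> *v axis j 1 = axis i 1"
proof -
  have "(fst (\<sigma> j) = fst (\<sigma> i') \<and> snd (\<sigma> j) = Suc (snd (\<sigma> i'))) \<longleftrightarrow> i' = i" for i'
    using assms by (metis fst_conv injD nat.inject prod.collapse snd_conv)
  then show ?thesis
    unfolding matrix_vector_mult_basis by (simp add: column_def chain_shift_def axis_def vec_eq_iff)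
qed

lemma column_chain_input:
  assumes "inj \<sigma>" "\<sigma> i = (l, k)" "Suc k = \<nu> l"
  shows "column l (chain_input \<nu> \<sigma>) = axis i 1"
proof -
  have "(fst (\<sigma> i') = l \<and> Suc (snd (\<sigma> i')) = \<nu> l) \<longleftrightarrow> i' = i" for i'
    using assms by (metis Suc_inject fst_conv injD prod.collapse snd_conv)
  then show ?thesis
    by (auto simp: column_def chain_input_def axis_def vec_eq_iff)
qed

lemma
  fixes \<sigma> :: "'n::finite \<Rightarrow> 'm::finite \<times> nat"
  assumes bij: "bij_betw \<sigma> UNIV (chain_indices \<nu>)" and \<nu>: "\<And>l. 1 \<le> \<nu> l"
  shows controllable_chain: "controllable (chain_shift \<sigma>) (chain_input \<nu> \<sigma>)"
    and rank_chain_input: "rank (chain_input \<nu> \<sigma>) = CARD('m)"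
proof -
  have inj: "inj \<sigma>" and range: "range \<sigma> = chain_indices \<nu>"
    using bij by (auto simp: bij_betw_def)
  have ex: "\<exists>i. \<sigma> i = (l, k)" if "k < \<nu> l" for l k
    using that range by (auto simp: chain_indices_def image_iff set_eq_iff) (metis lessThan_iff)
  have "CARD('n) = (\<Sum>l\<in>UNIV. \<nu> l)"
    using bij_betw_same_card[OF bij] by (simp add: card_chain_indices)
  then have \<nu>_le: "\<nu> l \<le> CARD('n)" for l
    using member_le_sum[of l UNIV \<nu>] by simp
  have "((*v) (chain_shift \<sigma>) ^^ d) (column l (chain_input \<nu> \<sigma>)) = axis i 1"
    if "\<sigma> i = (l, \<nu> l - 1 - d)" "d < \<nu> l" for d l i
    using that
  proof (induction d arbitrary: i)
    case 0
    then show ?case using column_chain_input[OF inj] \<nu>[of l] by simp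
  next
    case (Suc d)
    obtain j where j: "\<sigma> j = (l, \<nu> l - 1 - d)"
      using ex[of "\<nu> l - 1 - d" l] Suc.prems by auto
    moreover have "\<nu> l - 1 - d = Suc (\<nu> l - 1 - Suc d)" using Suc.prems(2) by simp
    ultimately show ?case
      using Suc.IH[OF j] Suc.prems chain_shift_axis[OF inj Suc.prems(1), of j] by simp
  qed
  note chain = this
  let ?K = "{((*v) (chain_shift \<sigma>) ^^ k) (column j (chain_input \<nu> \<sigma>)) |k j. k < CARD('n)}"
  have "axis i 1 \<in> ?K" for i
  proof -
    obtain l k where lk: "\<sigma> i = (l, k)" by (cases "\<sigma> i")
    then have "k < \<nu> l" using rangeI[of \<sigma> i] range by (auto simp: chain_indices_def)
    then have "axis i 1 = ((*v) (chain_shift \<sigma>) ^^ (\<nu> l - 1 - k)) (column l (chain_input \<nu> \<sigma>))"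
      using chain[of i l "\<nu> l - 1 - k"] lk by simp
    moreover have "\<nu> l - 1 - k < CARD('n)"
      using \<open>k < \<nu> l\<close> \<nu>_le[of l] by simp
    ultimately show ?thesis by blast
  qed
  then have "Basis \<subseteq> ?K"
    unfolding Basis_vec_def by auto
  from span_mono[OF this] show "controllable (chain_shift \<sigma>) (chain_input \<nu> \<sigma>)"
    unfolding controllable_def span_Basis by (rule top.extremum_uniqueI)
  have "inj ((*v) (chain_input \<nu> \<sigma>))"
    unfolding linear_injective_0[OF matrix_vector_mul_linear]
  proof (intro allI impI)
    fix w assume w: "chain_input \<nu> \<sigma> *v w = 0"
    show "w = 0"
      unfolding vec_eq_iff
    proof
      fix l
      obtain i where "\<sigma> i = (l, \<nu> l - 1)" using ex[of "\<nu> l - 1" l] \<nu>[of l] by auto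
      then show "w $ l = 0 $ l"
        using chain_input_apply[of \<sigma> i l "\<nu> l - 1" \<nu> w] w \<nu>[of l] by simp
    qed
  qed
  then show "rank (chain_input \<nu> \<sigma>) = CARD('m)"
    by (simp add: full_rank_injective)
qed

section \<open>Outputs with half-degree yield linearizing coordinates\<close>

lemma linear_quad_left: "linear (\<lambda>v. quad G v w)"
  by (rule linearI) (simp_all add: quad_def vec_eq_iff inner_add_left)

lemma quad_nth:
  "quad G v w $ i = (\<Sum>j\<in>UNIV. \<Sum>k\<in>UNIV. G $ i $ j $ k * v $ j * w $ k)"
  by (simp add: quad_def inner_vec_def matrix_vector_mult_def sum_distrib_left mult_ac)

text \<open>As the covariant differentials vanish, the differential of \<open>L\<^sub>e\<^sup>k\<^sup>+\<^sup>1 h\<^sub>l\<close> at \<open>x\<close> is obtained from that of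
\<open>L\<^sub>e\<^sup>k h\<^sub>l\<close> by the adjoint of \<open>w \<mapsto> \<nabla>\<^sub>w e\<close>. So these differentials form output chains, with \<open>P\<close>
evaluating a covector on the control fields, and being \<open>n\<close> in number they are a basis.\<close>
lemma half_degree_differentials_injective:
  fixes \<Gamma> :: "real^'n \<Rightarrow> real^'n^'n^'n" and h :: "'m::finite \<Rightarrow> real^'n \<Rightarrow> real"
  assumes S: "open S" "x \<in> S"
    and smooth: "smooth_on S e" "\<And>l. smooth_on S (h l)"
    and \<nu>: "\<And>l. 1 \<le> \<nu> l"
    and low: "\<And>l r q. q + 2 \<le> \<nu> l \<Longrightarrow> lie (g r) ((lie e ^^ q) (h l)) x = 0"
    and rank: "rank (decoupling_matrix e g h \<nu> x) = CARD('m)"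
    and nabla: "\<And>l k. k + 2 \<le> \<nu> l \<Longrightarrow> nabla_d \<Gamma> ((lie e ^^ k) (h l)) x = 0"
    and card: "(\<Sum>l\<in>UNIV. \<nu> l) = CARD('n)"
    and zero: "\<And>l k. k < \<nu> l \<Longrightarrow> frechet_derivative ((lie e ^^ k) (h l)) (at x) v = 0"
  shows "v = 0"
proof -
  define z where "z l k = (lie e ^^ k) (h l)" for l k
  have smooth_z: "smooth_on S (z l k)" for l k
    unfolding z_def using S(1) smooth by (rule smooth_on_lie_funpow)
  define \<omega> where "\<omega> l k = (\<chi> j. partial j (z l k) x)" for l k
  have \<omega>: "\<omega> l k \<bullet> w = frechet_derivative (z l k) (at x) w" for l k w
    unfolding frechet_derivative_axis_expansion[OF smooth_z S(2), of l k w]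
    by (simp add: \<omega>_def inner_vec_def partial_def mult.commute)
  \<comment> \<open>The covariant derivative of \<open>e\<close> in direction \<open>w\<close>.\<close>
  define M where "M w = quad (\<Gamma> x) w (e x) + frechet_derivative e (at x) w" for w
  have linM: "linear M"
    unfolding M_def
    by (intro linear_compose_add linear_quad_left
        has_derivative_linear[OF smooth_on_has_derivative[OF smooth(1) S(2)]])
  define P where "P a = (\<chi> r. a \<bullet> g r x)" for a
  have linP: "linear P"
    by (rule linearI) (simp_all add: P_def vec_eq_iff inner_add_left)
  have P\<omega>: "P (\<omega> l k) = (\<chi> r. lie (g r) (z l k) x)" for l k
    by (simp add: P_def \<omega> lie_def)
  have shift: "\<omega> l (Suc k) = adjoint M (\<omega> l k)" if "k + 2 \<le> \<nu> l" for l k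
  proof -
    have "\<omega> l (Suc k) \<bullet> w = \<omega> l k \<bullet> M w" for w
    proof -
      have "w \<bullet> (nabla_d \<Gamma> (z l k) x *v e x) = 0"
        using nabla[OF that] by (simp add: z_def)
      then have "frechet_derivative (\<lambda>y. frechet_derivative (z l k) (at y) (e x)) (at x) w =
          \<omega> l k \<bullet> quad (\<Gamma> x) w (e x)"
        by (simp add: nabla_d_apply[OF S(1) smooth_z S(2)] \<omega>)
      moreover have "z l (Suc k) = lie e (z l k)" by (simp add: z_def)
      ultimately show ?thesis
        by (simp add: \<omega>[of l "Suc k"] frechet_derivative_lie[OF S(1) smooth_z smooth(1) S(2)]
            M_def inner_add_right \<omega>[of l k "frechet_derivative e (at x) w"])
    qed
    then show ?thesis
      by (metis adjoint_works[OF linM] inner_commute vector_eq_ldot)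
  qed
  have pow: "(adjoint M ^^ k) (\<omega> l 0) = \<omega> l k" if "k < \<nu> l" for l k
    using that by (induction k) (auto simp: shift)
  have "output_chains (adjoint M) P (\<lambda>l. \<omega> l 0) \<nu>"
    unfolding output_chains_def
  proof (intro conjI allI impI)
    show "1 \<le> \<nu> l" for l by (rule \<nu>)
    show "P ((adjoint M ^^ q) (\<omega> l 0)) = 0" if "q + 2 \<le> \<nu> l" for l q
      using low[OF that] that by (simp add: pow P\<omega> z_def vec_eq_iff)
    fix b l assume b: "(\<Sum>l\<in>UNIV. b l *\<^sub>R P ((adjoint M ^^ (\<nu> l - 1)) (\<omega> l 0))) = 0"
    let ?A = "decoupling_matrix e g h \<nu> x"
    have "P ((adjoint M ^^ (\<nu> l - 1)) (\<omega> l 0)) = ?A $ l" for l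
      using \<nu>[of l] by (simp add: pow P\<omega> z_def decoupling_matrix_def vec_eq_iff)
    then have "transpose ?A *v (\<chi> l. b l) = 0"
      using b by (simp add: vec_eq_iff matrix_vector_mult_def transpose_def mult.commute)
    moreover have "inj ((*v) (transpose ?A))"
      using rank by (simp add: rank_transpose flip: full_rank_injective)
    ultimately have "(\<chi> l. b l) = 0"
      by (metis injD matrix_vector_mult_0_right)
    then show "b l = 0" by (simp add: vec_eq_iff)
  qed
  note ind = output_chains_independent[OF adjoint_linear[OF linM] linP this]
  define U where "U = (\<lambda>(l, k). (adjoint M ^^ k) (\<omega> l 0)) ` chain_indices \<nu>"
  have "card U = DIM(real^'n)"
    unfolding U_def using card_image[OF ind(1)] card by (simp add: card_chain_indices)
  then have "span U = UNIV"
    using ind(2) card_ge_dim_independent[of U UNIV] unfolding U_def[symmetric]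
    by (metis dim_UNIV order_refl subset_UNIV top.extremum_uniqueI)
  moreover have "u \<bullet> v = 0" if "u \<in> U" for u
    using that zero unfolding U_def by (auto simp: pow \<omega> chain_indices_def z_def)
  ultimately have "v \<bullet> v = 0"
    by (metis UNIV_I inner_commute orthogonal_def orthogonal_to_span)
  then show ?thesis by simp
qed

lemma smooth_on_nabla_d:
  assumes "open S" "smooth_on S \<Gamma>" "smooth_on S f"
  shows "smooth_on S (nabla_d \<Gamma> f)"
  unfolding nabla_d_def[abs_def]
  by (intro smooth_on_vec_lambda smooth_on_diff smooth_on_sum smooth_on_mult smooth_on_vec_nth
      smooth_on_partial assms)

text \<open>In the coordinates \<open>\<psi> = (L\<^sub>e\<^sup>k h\<^sub>l)\<close> the equations at the ends of the chains read
\<open>(\<nabla>dz)(v,v) + L\<^sub>e z + A u\<close>, where \<open>z = L\<^sub>e\<^bsup>\<nu>-1\<^esup> h\<close> and \<open>A\<close> is the decoupling matrix. The feedback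
solves \<open>(\<nabla>dz)(v,v) + L\<^sub>e z + A u = w\<close> for \<open>u\<close>.\<close>
proposition half_degree_imp_mf_linearizable:
  fixes \<Gamma> :: "real^'n \<Rightarrow> real^'n^'n^'n" and h :: "'m::finite \<Rightarrow> real^'n \<Rightarrow> real"
  assumes S: "open S" "p \<in> S"
    and smooth: "smooth_on S \<Gamma>" "smooth_on S e" "\<And>r. smooth_on S (g r)" "\<And>l. smooth_on S (h l)"
    and deg: "has_half_degree e g h p \<nu>" and card: "(\<Sum>l\<in>UNIV. \<nu> l) = CARD('n)"
    and flat: "\<forall>\<^sub>F x in nhds p. \<forall>l k. k + 2 \<le> \<nu> l \<longrightarrow> nabla_d \<Gamma> ((lie e ^^ k) (h l)) x = 0"
  shows "mf_linearizable S \<Gamma> e g p"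
proof -
  define z where "z l k = (lie e ^^ k) (h l)" for l k
  have z_Suc: "z l (Suc k) x = frechet_derivative (z l k) (at x) (e x)" for l k x
    by (simp add: z_def lie_def)
  define A where "A = decoupling_matrix e g h \<nu>"
  have \<nu>: "1 \<le> \<nu> l" for l
    using deg by (simp add: has_half_degree_def)
  define good where "good x \<longleftrightarrow> x \<in> S \<and>
      (\<forall>l r q. q + 2 \<le> \<nu> l \<longrightarrow> lie (g r) (z l q) x = 0) \<and> rank (A x) = CARD('m) \<and>
      (\<forall>l k. k + 2 \<le> \<nu> l \<longrightarrow> nabla_d \<Gamma> (z l k) x = 0)" for x
  have "\<forall>\<^sub>F x in nhds p. good x"
    using deg flat eventually_nhds_in_open[OF S] unfolding has_half_degree_def z_def A_def good_def
    by (simp add: eventually_conj_iff)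
  then obtain W where W: "open W" "p \<in> W" and good: "\<And>x. x \<in> W \<Longrightarrow> good x"
    unfolding eventually_nhds by blast
  have WS: "W \<subseteq> S"
    using good by (auto simp: good_def)
  have low: "lie (g r) (z l q) x = 0" if "x \<in> W" "q + 2 \<le> \<nu> l" for x l r q
    using good[OF that(1)] that(2) by (simp add: good_def)
  have rank: "rank (A x) = CARD('m)" if "x \<in> W" for x
    using good[OF that] by (simp add: good_def)
  have nabla: "nabla_d \<Gamma> (z l k) x = 0" if "x \<in> W" "k + 2 \<le> \<nu> l" for x l k
    using good[OF that(1)] that(2) by (simp add: good_def)
  have smooth_z: "smooth_on S (z l k)" for l k
    unfolding z_def using S(1) smooth(2,4) by (rule smooth_on_lie_funpow)
  obtain \<sigma> :: "'n \<Rightarrow> 'm \<times> nat" where bij: "bij_betw \<sigma> UNIV (chain_indices \<nu>)"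
    using finite_same_card_bij[of "UNIV :: 'n set" "chain_indices \<nu>"] card
    by (auto simp: card_chain_indices)
  then have inj: "inj \<sigma>" and range: "range \<sigma> = chain_indices \<nu>"
    by (auto simp: bij_betw_def)
  define \<psi> where "\<psi> x = (\<chi> i. z (fst (\<sigma> i)) (snd (\<sigma> i)) x)" for x
  have \<psi>_nth: "(\<lambda>x. \<psi> x $ i) = z l k" if "\<sigma> i = (l, k)" for i l k
    by (simp add: \<psi>_def that)
  have smooth_\<psi>: "smooth_on S \<psi>"
    unfolding \<psi>_def[abs_def] by (intro smooth_on_vec_lambda smooth_z S(1))
  have D\<psi>: "frechet_derivative \<psi> (at x) v $ i = frechet_derivative (z l k) (at x) v"
    if "x \<in> S" "\<sigma> i = (l, k)" for x v i l k
    using frechet_derivative_bounded_linear[OF bounded_linear_vec_nth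
        smooth_on_differentiable[OF smooth_\<psi> that(1)], of i v]
    by (simp add: \<psi>_nth[OF that(2)])
  have D2\<psi>: "frechet_derivative (\<lambda>y. frechet_derivative \<psi> (at y) v) (at x) w $ i =
      frechet_derivative (\<lambda>y. frechet_derivative (z l k) (at y) v) (at x) w"
    if "x \<in> S" "\<sigma> i = (l, k)" for x v w i l k
    using second_derivative_bounded_linear[OF S(1) smooth_\<psi> that(1) bounded_linear_vec_nth, of i v w]
    by (simp add: \<psi>_nth[OF that(2)])
  have lin\<psi>: "linear (frechet_derivative \<psi> (at x))" if "x \<in> S" for x
    using has_derivative_linear[OF smooth_on_has_derivative[OF smooth_\<psi> that]] .
  have "inj (frechet_derivative \<psi> (at p))"
    unfolding linear_injective_0[OF lin\<psi>[OF S(2)]]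
  proof (intro allI impI)
    fix v assume v: "frechet_derivative \<psi> (at p) v = 0"
    show "v = 0"
    proof (rule half_degree_differentials_injective[OF S smooth(2,4) \<nu> _ _ _ card])
      show "frechet_derivative ((lie e ^^ k) (h l)) (at p) v = 0" if "k < \<nu> l" for l k
      proof -
        have "(l, k) \<in> range \<sigma>" using that by (simp add: range chain_indices_def)
        then obtain i where i: "\<sigma> i = (l, k)" by auto
        show ?thesis using D\<psi>[OF S(2) i, of v] v by (simp add: z_def)
      qed
    qed (use low[OF W(2)] rank[OF W(2)] nabla[OF W(2)] in \<open>simp_all add: z_def A_def\<close>)
  qed
  then obtain V where V: "open V" "p \<in> V" "V \<subseteq> W" "smooth_diffeo_on V \<psi>"
    using smooth_local_diffeo[OF W(1) smooth_on_subset[OF smooth_\<psi> WS] W(2)] by blast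
  then have VS: "V \<subseteq> S" using WS by blast
  define \<beta> where "\<beta> x = matrix_inv (A x)" for x
  define \<alpha> where "\<alpha> x = - (\<beta> x *v (\<chi> l. z l (\<nu> l) x))" for x
  define N where "N l = nabla_d \<Gamma> (z l (\<nu> l - 1))" for l
  \<comment> \<open>Only the quadratic form of \<open>\<gamma>\<close> enters the dynamics, so its coefficients may be symmetrized.\<close>
  define \<gamma> :: "real^'n \<Rightarrow> real^'n^'n^'m"
    where "\<gamma> x = (\<chi> r j k. - (\<Sum>l\<in>UNIV. \<beta> x $ r $ l * (1/2 * (N l x $ j $ k + N l x $ k $ j))))" for x
  have invA: "invertible (A x)" if "x \<in> V" for x
    using rank[of x] that V(3)
    by (simp add: invertible_left_inverse matrix_left_invertible_injective subset_iff flip: full_rank_injective)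
  have A\<beta>: "A x *v (\<beta> x *v y) = y" if "x \<in> V" for x y
    by (simp add: \<beta>_def matrix_vector_mul_assoc matrix_inv_right[OF invA[OF that]])
  have smooth_A: "smooth_on V A"
    unfolding A_def decoupling_matrix_def[abs_def] z_def[symmetric]
    using VS by (intro smooth_on_vec_lambda V(1)) (rule smooth_on_subset[OF smooth_on_lie[OF S(1) smooth(3) smooth_z]])
  have smooth_\<beta>: "smooth_on V \<beta>"
    unfolding \<beta>_def[abs_def] by (rule smooth_on_matrix_inv[OF V(1) smooth_A invA])
  have smooth_\<alpha>: "smooth_on V \<alpha>"
    unfolding \<alpha>_def[abs_def]
    by (intro smooth_on_uminus smooth_on_bilinear[OF _ bounded_bilinear_matrix_vector_mult]
        smooth_on_vec_lambda smooth_\<beta> V(1) smooth_on_subset[OF smooth_z VS])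
  have smooth_N: "smooth_on V (N l)" for l
    unfolding N_def by (rule smooth_on_subset[OF smooth_on_nabla_d[OF S(1) smooth(1) smooth_z] VS])
  have smooth_\<gamma>: "smooth_on V \<gamma>"
    unfolding \<gamma>_def[abs_def]
    by (intro smooth_on_vec_lambda smooth_on_uminus smooth_on_sum smooth_on_mult smooth_on_vec_nth
        smooth_on_add smooth_on_const smooth_\<beta> smooth_N V(1))
  have quad_\<gamma>: "quad (\<gamma> x) v v = - (\<beta> x *v (\<chi> l. v \<bullet> (N l x *v v)))" for x v
  proof -
    have sym: "(\<Sum>j\<in>UNIV. \<Sum>k\<in>UNIV. (1/2 * (N l x $ j $ k + N l x $ k $ j)) * v $ j * v $ k) =
        v \<bullet> (N l x *v v)" for l
    proof -
      have "(\<Sum>j\<in>UNIV. \<Sum>k\<in>UNIV. N l x $ k $ j * v $ j * v $ k) =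
          (\<Sum>j\<in>UNIV. \<Sum>k\<in>UNIV. N l x $ j $ k * v $ j * v $ k)"
        by (subst sum.swap) (simp add: mult_ac)
      moreover have "v \<bullet> (N l x *v v) = (\<Sum>j\<in>UNIV. \<Sum>k\<in>UNIV. N l x $ j $ k * v $ j * v $ k)"
        by (simp add: inner_vec_def matrix_vector_mult_def sum_distrib_left mult_ac)
      ultimately show ?thesis
        by (simp add: distrib_left distrib_right sum.distrib mult.assoc flip: sum_divide_distrib)
    qed
    have "quad (\<gamma> x) v v $ r = - (\<Sum>l\<in>UNIV. \<beta> x $ r $ l *
        (\<Sum>j\<in>UNIV. \<Sum>k\<in>UNIV. (1/2 * (N l x $ j $ k + N l x $ k $ j)) * v $ j * v $ k))" for r
    proof -
      have "quad (\<gamma> x) v v $ r = - (\<Sum>j\<in>UNIV. \<Sum>k\<in>UNIV. \<Sum>l\<in>UNIV.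
          \<beta> x $ r $ l * ((1/2 * (N l x $ j $ k + N l x $ k $ j)) * v $ j * v $ k))"
        unfolding quad_nth \<gamma>_def by (simp add: sum_distrib_right mult.assoc sum_negf)
      also have "\<dots> = - (\<Sum>j\<in>UNIV. \<Sum>l\<in>UNIV. \<Sum>k\<in>UNIV.
          \<beta> x $ r $ l * ((1/2 * (N l x $ j $ k + N l x $ k $ j)) * v $ j * v $ k))"
        by (intro arg_cong[where f=uminus] sum.cong[OF refl] sum.swap)
      also have "\<dots> = - (\<Sum>l\<in>UNIV. \<Sum>j\<in>UNIV. \<Sum>k\<in>UNIV.
          \<beta> x $ r $ l * ((1/2 * (N l x $ j $ k + N l x $ k $ j)) * v $ j * v $ k))"
        by (intro arg_cong[where f=uminus] sum.swap)
      finally show ?thesis by (simp only: sum_distrib_left)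
    qed
    then show ?thesis
      unfolding sym by (simp add: vec_eq_iff matrix_vector_mult_def)
  qed
  have conjugates: "frechet_derivative (tangent_map \<psi>) (at (x, v))
       (mechanical_system \<Gamma> e g (x, v) (mechanical_feedback \<gamma> \<alpha> \<beta> (x, v) w)) =
     linear_mechanical_system (chain_shift \<sigma>) (chain_input \<nu> \<sigma>) (tangent_map \<psi> (x, v)) w"
    if "x \<in> V" for x v w
  proof -
    have xW: "x \<in> W" and xS: "x \<in> S" using that V(3) WS by auto
    define u where "u = mechanical_feedback \<gamma> \<alpha> \<beta> (x, v) w"
    define a where "a = - quad (\<Gamma> x) v v + e x + (\<Sum>r\<in>UNIV. (u $ r) *\<^sub>R g r x)"
    have "u = \<beta> x *v (w - (\<chi> l. v \<bullet> (N l x *v v)) - (\<chi> l. z l (\<nu> l) x))"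
      by (simp add: u_def mechanical_feedback_def quad_\<gamma> \<alpha>_def matrix_vector_mult_diff_distrib)
    then have Au: "A x *v u = w - (\<chi> l. v \<bullet> (N l x *v v)) - (\<chi> l. z l (\<nu> l) x)"
      by (simp add: A\<beta>[OF that])
    have "frechet_derivative (\<lambda>y. frechet_derivative \<psi> (at y) v) (at x) v + frechet_derivative \<psi> (at x) a
        = chain_shift \<sigma> *v \<psi> x + chain_input \<nu> \<sigma> *v w"
      unfolding vec_eq_iff
    proof
      fix i
      obtain l k where i: "\<sigma> i = (l, k)" by (cases "\<sigma> i")
      then have k: "k < \<nu> l" using rangeI[of \<sigma> i] range by (auto simp: chain_indices_def)
      have linz: "linear (frechet_derivative (z l k) (at x))"
        using has_derivative_linear[OF smooth_on_has_derivative[OF smooth_z xS]] .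
      have "(frechet_derivative (\<lambda>y. frechet_derivative \<psi> (at y) v) (at x) v + frechet_derivative \<psi> (at x) a) $ i
        = frechet_derivative (\<lambda>y. frechet_derivative (z l k) (at y) v) (at x) v
          + frechet_derivative (z l k) (at x) a"
        by (simp add: D\<psi>[OF xS i] D2\<psi>[OF xS i])
      also have "\<dots> = v \<bullet> (nabla_d \<Gamma> (z l k) x *v v) + z l (Suc k) x
          + (\<Sum>r\<in>UNIV. u $ r * lie (g r) (z l k) x)"
        by (simp add: a_def linear_add[OF linz] linear_neg[OF linz] linear_diff[OF linz] linear_sum[OF linz]
            linear_scale[OF linz] nabla_d_apply[OF S(1) smooth_z xS] z_Suc lie_def)
      also have "\<dots> = (chain_shift \<sigma> *v \<psi> x + chain_input \<nu> \<sigma> *v w) $ i"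
      proof (cases "Suc k = \<nu> l")
        case True
        then have k_last: "\<nu> l - 1 = k" by simp
        have "(\<Sum>r\<in>UNIV. u $ r * lie (g r) (z l k) x) = (A x *v u) $ l"
          unfolding A_def decoupling_matrix_def matrix_vector_mult_def vec_lambda_beta k_last z_def
          by (simp add: mult.commute)
        also have "\<dots> = w $ l - v \<bullet> (nabla_d \<Gamma> (z l k) x *v v) - z l (Suc k) x"
          unfolding Au N_def True by (simp add: k_last[simplified])
        finally show ?thesis
          using chain_shift_apply_last[OF range i True, of "\<psi> x"]
            chain_input_apply[of \<sigma> i l k \<nu> w, OF i] True
          by simp
      next
        case False
        then have k2: "k + 2 \<le> \<nu> l" using k by simp
        then have "(l, Suc k) \<in> range \<sigma>" by (simp add: range chain_indices_def)
        then obtain j where j: "\<sigma> j = (l, Suc k)" by auto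
        show ?thesis
          using chain_shift_apply[OF inj i j] chain_input_apply[of \<sigma> i l k \<nu> w, OF i] False
            nabla[OF xW k2] low[OF xW k2] fun_cong[OF \<psi>_nth[OF j], of x]
          by simp
      qed
      finally show "(frechet_derivative (\<lambda>y. frechet_derivative \<psi> (at y) v) (at x) v
          + frechet_derivative \<psi> (at x) a) $ i
        = (chain_shift \<sigma> *v \<psi> x + chain_input \<nu> \<sigma> *v w) $ i" .
    qed
    moreover have "mechanical_system \<Gamma> e g (x, v) u = (v, a)"
      by (simp add: mechanical_system_def a_def)
    ultimately show ?thesis
      unfolding u_def[symmetric]
      by (simp add: frechet_derivative_tangent_map[OF S(1) smooth_\<psi> xS] linear_mechanical_system_def
          tangent_map_apply)
  qed
  have sym_\<gamma>: "\<gamma> x $ r $ j $ k = \<gamma> x $ r $ k $ j" for x r j k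
    by (simp add: \<gamma>_def add.commute)
  have inv_\<beta>: "invertible (\<beta> x)" if "x \<in> V" for x
    unfolding \<beta>_def invertible_def using matrix_inv[OF invA[OF that]] by blast
  have "mf_equivalent_to_linear S \<Gamma> e g p (chain_shift \<sigma>) (chain_input \<nu> \<sigma>)"
    unfolding mf_equivalent_to_linear_def
    by (intro exI[of _ V] exI[of _ \<psi>] exI[of _ \<gamma>] exI[of _ \<alpha>] exI[of _ \<beta>] conjI ballI allI
        V(1,2,4) VS smooth_\<alpha> smooth_\<beta> smooth_\<gamma> sym_\<gamma> inv_\<beta> conjugates)
  then show ?thesis
    unfolding mf_linearizable_def
    using controllable_chain[OF bij \<nu>] rank_chain_input[OF bij \<nu>] by blast
qed

section \<open>Linearizable systems have such outputs\<close>

lemma nabla_d_symmetric: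
  assumes "open S" "smooth_on S f" "x \<in> S"
    and "\<And>i j k. \<Gamma> x $ i $ j $ k = \<Gamma> x $ i $ k $ j"
  shows "nabla_d \<Gamma> f x $ j $ k = nabla_d \<Gamma> f x $ k $ j"
proof -
  have "Ck_on 2 S f" using assms(2) by (simp add: smooth_on_def)
  from second_derivative_symmetric[OF assms(1) this assms(3)]
  have "partial j (partial k f) x = partial k (partial j f) x"
    unfolding partial_def[abs_def] .
  then show ?thesis
    using assms(4)[of _ j k] by (simp add: nabla_d_def)
qed

lemma symmetric_matrix_zero:
  fixes N :: "real^'n^'n"
  assumes sym: "\<And>j k. N $ j $ k = N $ k $ j" and zero: "\<And>v. v \<bullet> (N *v v) = 0"
  shows "N = 0"
proof -
  have entry: "axis j 1 \<bullet> (N *v axis k 1) = N $ j $ k" for j k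
    by (simp add: matrix_vector_mult_basis column_def inner_axis')
  have "N $ j $ k = 0" for j k
  proof -
    have "0 = (axis j 1 + axis k 1) \<bullet> (N *v (axis j 1 + axis k 1))"
      by (simp add: zero)
    also have "\<dots> = N $ j $ k + N $ k $ j"
      using zero[of "axis j 1"] zero[of "axis k 1"]
      by (simp add: matrix_vector_right_distrib inner_add_left inner_add_right entry del: inner_axis')
    finally show ?thesis using sym[of j k] by simp
  qed
  then show ?thesis by (simp add: vec_eq_iff)
qed

lemma inner_transpose: "(transpose E *v x) \<bullet> y = x \<bullet> (E *v y)" for E :: "real^'n^'m"
  by (simp add: dot_lmul_matrix)

lemma inner_funpow_adjoint:
  fixes E :: "real^'n^'n"
  shows "((*v) (transpose E) ^^ k) x \<bullet> y = x \<bullet> ((*v) E ^^ k) y"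
proof (induction k arbitrary: y)
  case (Suc k)
  have "((*v) (transpose E) ^^ Suc k) x \<bullet> y = ((*v) (transpose E) ^^ k) x \<bullet> (E *v y)"
    by (simp add: inner_transpose del: transpose_matrix_vector)
  then show ?case
    unfolding Suc.IH by (simp only: funpow_swap1 funpow.simps o_apply)
qed simp

text \<open>Controllability says that a covector \<open>x\<close> with \<open>x E\<^sup>q B = 0\<close> for all \<open>q < n\<close> vanishes, and the rank
condition that \<open>x \<mapsto> x B\<close> is onto.\<close>
proposition exists_chain_outputs:
  fixes E :: "real^'n^'n" and B :: "real^'m::finite^'n"
  assumes "controllable E B" "rank B = CARD('m)"
  obtains c :: "'m \<Rightarrow> real^'n" and \<nu>
  where "output_chains ((*v) (transpose E)) ((*v) (transpose B)) c \<nu>" "(\<Sum>l\<in>UNIV. \<nu> l) = CARD('n)"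
proof -
  have "surj ((*v) (transpose B))"
    unfolding full_rank_surjective[symmetric] rank_transpose by (rule assms(2))
  moreover have "x = 0"
    if x: "\<And>q. q < CARD('n) \<Longrightarrow> transpose B *v (((*v) (transpose E) ^^ q) x) = 0" for x
  proof -
    have "x \<bullet> y = 0" if y: "y \<in> {((*v) E ^^ k) (column j B) |k j. k < CARD('n)}" for y
    proof -
      obtain k j where k: "k < CARD('n)" and y: "y = ((*v) E ^^ k) (column j B)"
        using y by blast
      have "x \<bullet> y = (transpose B *v (((*v) (transpose E) ^^ k) x)) $ j"
        unfolding y inner_funpow_adjoint[symmetric]
        by (simp add: matrix_vector_mult_def inner_vec_def column_def transpose_def mult.commute)
      then show ?thesis using x[OF k] by simp
    qed
    then have "orthogonal x y" if "y \<in> span {((*v) E ^^ k) (column j B) |k j. k < CARD('n)}" for y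
      unfolding orthogonal_def[symmetric] using that by (rule orthogonal_to_span[rotated])
    then have "orthogonal x x"
      using assms(1) unfolding controllable_def by blast
    then show "x = 0" by (simp add: orthogonal_def)
  qed
  ultimately show thesis
    using exists_output_chains_basis[of "(*v) (transpose E)" "(*v) (transpose B)" "CARD('n)"] that
    by auto
qed

text \<open>The pushed-forward dynamics is an identity in \<open>v\<close> and \<open>w\<close>. Its part without \<open>v\<close> gives
\<open>D\<psi> e + \<Sum>\<^sub>r \<alpha>\<^sub>r D\<psi> g\<^sub>r = E \<psi>\<close> and \<open>D\<psi> g\<^sub>r = B \<beta>\<^sup>-\<^sup>1 e\<^sub>r\<close>, and its quadratic part relates the
covariant second derivative of \<open>\<psi>\<close> to the vectors \<open>D\<psi> g\<^sub>r\<close>. A covector \<open>a\<close> with \<open>a B = 0\<close> annihilates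
every \<open>D\<psi> g\<^sub>r\<close>, so for \<open>f = a \<psi>\<close> the feedback disappears: \<open>L\<^sub>e f = a E \<psi>\<close> and \<open>\<nabla>df = 0\<close>.\<close>
proposition mf_linearizable_imp_half_degree:
  fixes \<Gamma> :: "real^'n \<Rightarrow> real^'n^'n^'n" and g :: "'m::finite \<Rightarrow> real^'n \<Rightarrow> real^'n"
  assumes sym: "\<And>x i j k. x \<in> S \<Longrightarrow> \<Gamma> x $ i $ j $ k = \<Gamma> x $ i $ k $ j"
    and lin: "mf_linearizable S \<Gamma> e g p"
  obtains V H \<nu> where "open V" "p \<in> V" "V \<subseteq> S" "\<And>l. smooth_on V (H l)"
    "\<And>l. 1 \<le> \<nu> l" "(\<Sum>l\<in>UNIV. \<nu> l) = CARD('n)"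
    "\<And>x l r q. x \<in> V \<Longrightarrow> q + 2 \<le> \<nu> l \<Longrightarrow> lie (g r) ((lie e ^^ q) (H l)) x = 0"
    "\<And>x. x \<in> V \<Longrightarrow> rank (decoupling_matrix e g H \<nu> x) = CARD('m)"
    "\<And>x l k. x \<in> V \<Longrightarrow> k + 2 \<le> \<nu> l \<Longrightarrow> nabla_d \<Gamma> ((lie e ^^ k) (H l)) x = 0"
proof -
  obtain E and B :: "real^'m^'n" where EB: "controllable E B" "rank B = CARD('m)"
    and equiv_lin: "mf_equivalent_to_linear S \<Gamma> e g p E B"
    using lin unfolding mf_linearizable_def by blast
  define conjugates where "conjugates V \<psi> \<gamma> \<alpha> \<beta> \<longleftrightarrow> (\<forall>x\<in>V. \<forall>v w.
           frechet_derivative (tangent_map \<psi>) (at (x, v))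
             (mechanical_system \<Gamma> e g (x, v) (mechanical_feedback \<gamma> \<alpha> \<beta> (x, v) w)) =
           linear_mechanical_system E B (tangent_map \<psi> (x, v)) w)" for V \<psi> \<gamma> \<alpha> \<beta>
  obtain V \<psi> \<gamma> \<alpha> \<beta> where V: "open V" "p \<in> V" "V \<subseteq> S" and diffeo: "smooth_diffeo_on V \<psi>"
    and inv\<beta>: "\<And>x. x \<in> V \<Longrightarrow> invertible (\<beta> x)" and "conjugates V \<psi> \<gamma> \<alpha> \<beta>"
  proof -
    have "\<exists>V \<psi> \<gamma> \<alpha> \<beta>. open V \<and> p \<in> V \<and> V \<subseteq> S \<and> smooth_diffeo_on V \<psi> \<and>
        smooth_on V \<gamma> \<and> smooth_on V \<alpha> \<and> smooth_on V \<beta> \<and>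
        (\<forall>x\<in>V. (\<forall>r j k. \<gamma> x $ r $ j $ k = \<gamma> x $ r $ k $ j) \<and> invertible (\<beta> x)) \<and>
        conjugates V \<psi> \<gamma> \<alpha> \<beta>"
      using equiv_lin unfolding mf_equivalent_to_linear_def conjugates_def .
    then show ?thesis
      by (elim exE conjE) (rule that[rotated 5], assumption, assumption+, blast)
  qed
  then have equiv: "frechet_derivative (tangent_map \<psi>) (at (x, v))
             (mechanical_system \<Gamma> e g (x, v) (mechanical_feedback \<gamma> \<alpha> \<beta> (x, v) w)) =
           linear_mechanical_system E B (tangent_map \<psi> (x, v)) w" if "x \<in> V" for x v w
    using that by (simp add: conjugates_def)
  have smooth_\<psi>: "smooth_on V \<psi>" using diffeo by (simp add: smooth_diffeo_on_def)
  define F where "F = (*v) (transpose E)"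
  define P where "P = (*v) (transpose B)"
  obtain c :: "'m \<Rightarrow> real^'n" and \<nu> where ch: "output_chains F P c \<nu>" and card: "(\<Sum>l\<in>UNIV. \<nu> l) = CARD('n)"
    unfolding F_def P_def by (rule exists_chain_outputs[OF EB]) (rule that[unfolded F_def P_def])
  have \<nu>: "1 \<le> \<nu> l" and low: "q + 2 \<le> \<nu> l \<Longrightarrow> P ((F ^^ q) (c l)) = 0"
    and lead: "(\<Sum>l\<in>UNIV. b l *\<^sub>R P ((F ^^ (\<nu> l - 1)) (c l))) = 0 \<Longrightarrow> b l = 0" for l q b
    using ch by (auto simp: output_chains_def)
  define f where "f a x = a \<bullet> \<psi> x" for a x
  have smooth_f: "smooth_on V (f a)" for a
    unfolding f_def[abs_def] by (intro smooth_on_inner smooth_on_const smooth_\<psi> V(1))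
  define D where "D x = frechet_derivative \<psi> (at x)" for x
  have linD: "linear (D x)" if "x \<in> V" for x
    unfolding D_def using has_derivative_linear[OF smooth_on_has_derivative[OF smooth_\<psi> that]] .
  have Df: "frechet_derivative (f a) (at x) v = a \<bullet> D x v" if "x \<in> V" for a x v
    unfolding f_def[abs_def] D_def
    using frechet_derivative_bounded_linear[OF bounded_linear_inner_right
        smooth_on_differentiable[OF smooth_\<psi> that]] .
  have D2f: "frechet_derivative (\<lambda>y. frechet_derivative (f a) (at y) v) (at x) w =
      a \<bullet> frechet_derivative (\<lambda>y. D y v) (at x) w" if "x \<in> V" for a x v w
    unfolding f_def[abs_def] D_def
    using second_derivative_bounded_linear[OF V(1) smooth_\<psi> that bounded_linear_inner_right] .
  have dyn: "frechet_derivative (\<lambda>y. D y v) (at x) v - D x (quad (\<Gamma> x) v v) + D x (e x)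
      + (\<Sum>r\<in>UNIV. (quad (\<gamma> x) v v + \<alpha> x + \<beta> x *v w) $ r *\<^sub>R D x (g r x)) = E *v \<psi> x + B *v w"
    if "x \<in> V" for x v w
  proof -
    have closed: "frechet_derivative (\<lambda>y. D y v) (at x) v + D x (- quad (\<Gamma> x) v v + e x
      + (\<Sum>r\<in>UNIV. (quad (\<gamma> x) v v + \<alpha> x + \<beta> x *v w) $ r *\<^sub>R g r x)) = E *v \<psi> x + B *v w"
      using equiv[OF that, of v w] unfolding D_def
      by (simp add: mechanical_system_def mechanical_feedback_def linear_mechanical_system_def
          tangent_map_apply
          frechet_derivative_tangent_map[OF V(1) smooth_\<psi> that])
    have "D x (- quad (\<Gamma> x) v v + e x
      + (\<Sum>r\<in>UNIV. (quad (\<gamma> x) v v + \<alpha> x + \<beta> x *v w) $ r *\<^sub>R g r x)) =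
      - D x (quad (\<Gamma> x) v v) + D x (e x)
      + (\<Sum>r\<in>UNIV. (quad (\<gamma> x) v v + \<alpha> x + \<beta> x *v w) $ r *\<^sub>R D x (g r x))"
      by (simp only: linear_add[OF linD[OF that]] linear_neg[OF linD[OF that]]
          linear_sum[OF linD[OF that]] linear_scale[OF linD[OF that]])
    with closed show ?thesis by (simp only: add.assoc diff_conv_add_uminus)
  qed
  have quad0: "quad G 0 0 = 0" for G :: "real^'n^'n^'i::finite"
    by (simp add: quad_def vec_eq_iff)
  have D20: "frechet_derivative (\<lambda>y. D y 0) (at x) w = 0" if "x \<in> V" for x w
  proof -
    have "frechet_derivative (\<lambda>y. D y 0) (at x) = frechet_derivative (\<lambda>y. 0 :: real^'n) (at x)"
      by (rule frechet_derivative_cong_open[OF V(1) that]) (rule linear_0[OF linD])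
    then show ?thesis by simp
  qed
  have drift: "D x (e x) + (\<Sum>r\<in>UNIV. \<alpha> x $ r *\<^sub>R D x (g r x)) = E *v \<psi> x" if "x \<in> V" for x
    using dyn[OF that, of 0 0] by (simp add: quad0 D20[OF that] linear_0[OF linD[OF that]])
  have Dg: "D x (g r x) = B *v (matrix_inv (\<beta> x) *v axis r 1)" if "x \<in> V" for x r
  proof -
    let ?w = "matrix_inv (\<beta> x) *v axis r 1"
    have w: "\<beta> x *v ?w = axis r 1"
      by (simp only: matrix_vector_mul_assoc matrix_inv_right[OF inv\<beta>[OF that]] matrix_vector_mul_lid)
    have "(\<Sum>s\<in>UNIV. axis r 1 $ s *\<^sub>R D x (g s x)) = D x (g r x)"
      by (simp add: axis_def if_distrib[where f="\<lambda>a. a *\<^sub>R _"] cong: if_cong)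
    then have "D x (e x) + (\<Sum>s\<in>UNIV. \<alpha> x $ s *\<^sub>R D x (g s x)) + D x (g r x) = E *v \<psi> x + B *v ?w"
      using dyn[OF that, of 0 ?w]
      by (simp add: w quad0 D20[OF that] linear_0[OF linD[OF that]] scaleR_left_distrib sum.distrib
          add.assoc)
    then show ?thesis using drift[OF that] by simp
  qed
  have lie_g: "lie (g r) (f a) x = P a \<bullet> (matrix_inv (\<beta> x) *v axis r 1)" if "x \<in> V" for r a x
    by (simp add: lie_def Df[OF that] Dg[OF that] P_def inner_transpose del: transpose_matrix_vector)
  have Dg0: "a \<bullet> D x (g r x) = 0" if "x \<in> V" "P a = 0" for x a r
    using lie_g[OF that(1), of r a] that by (simp add: lie_def Df)
  have lie_e: "lie e (f a) x = f (F a) x" if "x \<in> V" "P a = 0" for x a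
  proof -
    have "a \<bullet> D x (e x) = a \<bullet> (E *v \<psi> x)"
      unfolding drift[OF that(1), symmetric]
      by (simp add: inner_add_right inner_sum_right Dg0[OF that])
    then show ?thesis
      by (simp add: lie_def Df[OF that(1)] f_def F_def inner_transpose del: transpose_matrix_vector)
  qed
  have nabla_f: "nabla_d \<Gamma> (f a) x = 0" if "x \<in> V" "P a = 0" for x a
  proof (rule symmetric_matrix_zero)
    show "nabla_d \<Gamma> (f a) x $ j $ k = nabla_d \<Gamma> (f a) x $ k $ j" for j k
      using that(1) V(3) by (intro nabla_d_symmetric[OF V(1) smooth_f that(1)] sym) blast
    show "v \<bullet> (nabla_d \<Gamma> (f a) x *v v) = 0" for v
    proof -
      have "v \<bullet> (nabla_d \<Gamma> (f a) x *v v) =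
          a \<bullet> (frechet_derivative (\<lambda>y. D y v) (at x) v - D x (quad (\<Gamma> x) v v))"
        by (simp add: nabla_d_apply[OF V(1) smooth_f that(1)] Df[OF that(1)] D2f[OF that(1)]
            inner_diff_right)
      also have "frechet_derivative (\<lambda>y. D y v) (at x) v - D x (quad (\<Gamma> x) v v) =
          E *v \<psi> x - D x (e x) - (\<Sum>r\<in>UNIV. (quad (\<gamma> x) v v + \<alpha> x) $ r *\<^sub>R D x (g r x))"
        using dyn[OF that(1), of v 0] by (simp add: algebra_simps)
      also have "a \<bullet> \<dots> = 0"
        unfolding drift[OF that(1), symmetric]
        by (simp add: inner_add_right inner_diff_right inner_sum_right Dg0[OF that])
      finally show ?thesis .
    qed
  qed
  have pow: "(lie e ^^ k) (f (c l)) x = f ((F ^^ k) (c l)) x" if "x \<in> V" "k < \<nu> l" for x k l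
    using that
  proof (induction k arbitrary: x)
    case (Suc k)
    have "lie e ((lie e ^^ k) (f (c l))) x = lie e (f ((F ^^ k) (c l))) x"
      by (rule lie_cong_open[OF V(1) Suc.prems(1)]) (use Suc in simp)
    also have "\<dots> = f (F ((F ^^ k) (c l))) x"
      using Suc.prems low[of k l] by (intro lie_e) auto
    finally show ?case by simp
  qed simp
  show thesis
  proof (rule that[OF V, of "\<lambda>l. f (c l)" \<nu>])
    show "smooth_on V (f (c l))" for l by (rule smooth_f)
    show "1 \<le> \<nu> l" for l by (rule \<nu>)
    show "(\<Sum>l\<in>UNIV. \<nu> l) = CARD('n)" by (rule card)
    show "lie (g r) ((lie e ^^ q) (f (c l))) x = 0" if "x \<in> V" "q + 2 \<le> \<nu> l" for x l r q
    proof -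
      have "lie (g r) ((lie e ^^ q) (f (c l))) x = lie (g r) (f ((F ^^ q) (c l))) x"
        by (rule lie_cong_open[OF V(1) that(1)]) (use that(2) in \<open>simp add: pow\<close>)
      then show ?thesis using low[OF that(2)] by (simp add: lie_g[OF that(1)])
    qed
    show "nabla_d \<Gamma> ((lie e ^^ k) (f (c l))) x = 0" if "x \<in> V" "k + 2 \<le> \<nu> l" for x l k
    proof -
      have "nabla_d \<Gamma> ((lie e ^^ k) (f (c l))) x = nabla_d \<Gamma> (f ((F ^^ k) (c l))) x"
        by (rule nabla_d_cong_open[OF V(1) that(1)]) (use that(2) in \<open>simp add: pow\<close>)
      then show ?thesis using nabla_f[OF that(1) low[OF that(2)]] by simp
    qed
    show "rank (decoupling_matrix e g (\<lambda>l. f (c l)) \<nu> x) = CARD('m)" if "x \<in> V" for x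
    proof -
      \<comment> \<open>The decoupling matrix factors as \<open>\<Lambda> \<beta>\<^sup>-\<^sup>1\<close>, where the rows of \<open>\<Lambda>\<close> are the covectors \<open>c\<^sub>l E\<^bsup>\<nu>\<^sub>l-1\<^esup> B\<close>.\<close>
      define \<Lambda> :: "real^'m^'m" where "\<Lambda> = (\<chi> l. P ((F ^^ (\<nu> l - 1)) (c l)))"
      have "decoupling_matrix e g (\<lambda>l. f (c l)) \<nu> x $ l $ r = (\<Lambda> ** matrix_inv (\<beta> x)) $ l $ r" for l r
      proof -
        have "lie (g r) ((lie e ^^ (\<nu> l - 1)) (f (c l))) x = lie (g r) (f ((F ^^ (\<nu> l - 1)) (c l))) x"
          using \<nu>[of l] by (intro lie_cong_open[OF V(1) that]) (simp add: pow)
        then show ?thesis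
          by (simp add: decoupling_matrix_def lie_g[OF that] \<Lambda>_def matrix_matrix_mult_def
              matrix_vector_mult_basis column_def inner_vec_def)
      qed
      then have eq: "decoupling_matrix e g (\<lambda>l. f (c l)) \<nu> x = \<Lambda> ** matrix_inv (\<beta> x)"
        by (simp add: vec_eq_iff)
      have "inj ((*v) (transpose \<Lambda>))"
        unfolding linear_injective_0[OF matrix_vector_mul_linear]
      proof (intro allI impI)
        fix b assume b: "transpose \<Lambda> *v b = 0"
        have "(\<Sum>l\<in>UNIV. (b $ l) *\<^sub>R P ((F ^^ (\<nu> l - 1)) (c l))) = transpose \<Lambda> *v b"
          by (simp add: vec_eq_iff \<Lambda>_def matrix_vector_mult_def transpose_def mult.commute)
        then have "b $ l = 0" for l using lead[of "\<lambda>l. b $ l" l] b by simp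
        then show "b = 0" by (simp add: vec_eq_iff)
      qed
      then have "invertible (transpose \<Lambda>)"
        by (simp add: invertible_left_inverse matrix_left_invertible_injective)
      then have "invertible \<Lambda>"
        by (simp add: invertible_det_nz)
      moreover have "invertible (matrix_inv (\<beta> x))"
        unfolding invertible_def using matrix_inv[OF inv\<beta>[OF that]] by blast
      ultimately have "invertible (\<Lambda> ** matrix_inv (\<beta> x))"
        by (rule invertible_mult)
      then show ?thesis
        by (simp add: eq full_rank_injective invertible_left_inverse matrix_left_invertible_injective)
    qed
  qed
qed

section \<open>Extending functions from a chart to the manifold\<close>

lemma chart_properties:
  assumes "smooth_atlas A" "c \<in> A"
  shows open_chart_domain: "open (fst c)" and open_chart_image: "open (chart_image c)"
    and continuous_on_chart: "continuous_on (fst c) (snd c)"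
    and continuous_on_chart_inv: "continuous_on (chart_image c) (chart_inv c)"
    and chart_inv_chart: "q \<in> fst c \<Longrightarrow> chart_inv c (snd c q) = q"
    and chart_chart_inv: "y \<in> chart_image c \<Longrightarrow> snd c (chart_inv c y) = y"
    and chart_inv_in: "y \<in> chart_image c \<Longrightarrow> chart_inv c y \<in> fst c"
    and chart_in: "q \<in> fst c \<Longrightarrow> snd c q \<in> chart_image c"
  using assms unfolding smooth_atlas_def homeomorphism_def by blast+

lemma open_chart_image_subset:
  assumes "smooth_atlas A" "c \<in> A" "open U" "U \<subseteq> fst c"
  shows "open (snd c ` U)"
proof -
  have "snd c ` U = chart_image c \<inter> chart_inv c -` U"
    using assms(4) chart_inv_chart[OF assms(1,2)] chart_chart_inv[OF assms(1,2)]
      chart_in[OF assms(1,2)] by (force simp: image_iff)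
  then show ?thesis
    using continuous_open_preimage[OF continuous_on_chart_inv[OF assms(1,2)]
        open_chart_image[OF assms(1,2)] assms(3)] by simp
qed

text \<open>Multiply \<open>H\<close> by a bump function in the chart and extend by zero. The support lies in the image \<open>K\<close>
of a closed ball. It is compact, hence closed in the Hausdorff space \<open>'q\<close>, so the extension is zero
on the open complement of \<open>K\<close>.\<close>
proposition smooth_function_extension:
  fixes A :: "('q::{t2_space,second_countable_topology}, 'n::finite) chart set"
  assumes A: "smooth_atlas A" "c \<in> A" and p: "p \<in> V" and V: "open V" "V \<subseteq> chart_image c"
    and H: "smooth_on V (H :: real^'n \<Rightarrow> real)"
  obtains h V' where "smooth_function A h" "open V'" "p \<in> V'" "V' \<subseteq> V"
    "\<And>y. y \<in> V' \<Longrightarrow> (h \<circ> chart_inv c) y = H y"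
proof -
  obtain R where R: "R > 0" "cball p R \<subseteq> V"
    using V(1) p open_contains_cball by blast
  define r where "r = R / 2"
  have r: "r > 0" and ballV: "cball p (2 * r) \<subseteq> V" using R by (auto simp: r_def)
  obtain \<rho> :: "real^'n \<Rightarrow> real" where \<rho>: "smooth_on UNIV \<rho>"
    "\<And>y. dist p y \<le> r \<Longrightarrow> \<rho> y = 1" "\<And>y. dist p y \<ge> 2 * r \<Longrightarrow> \<rho> y = 0"
    using exists_bump_function[OF r] by metis
  define h where "h q = (if q \<in> fst c \<and> snd c q \<in> V then \<rho> (snd c q) * H (snd c q) else 0)" for q
  define K where "K = chart_inv c ` cball p (2 * r)"
  have "compact K"
    unfolding K_def
    by (rule compact_continuous_image[OF continuous_on_subset[OF continuous_on_chart_inv[OF A]]])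
      (use ballV V(2) in auto)
  then have openK: "open (- K)"
    by (simp add: compact_imp_closed open_Compl)
  have h0: "h q = 0" if "q \<notin> K" for q
  proof (rule ccontr)
    assume "h q \<noteq> 0"
    then have q: "q \<in> fst c" "snd c q \<in> V" and "\<rho> (snd c q) \<noteq> 0"
      by (auto simp: h_def split: if_splits)
    then have "snd c q \<in> cball p (2 * r)" using \<rho>(3)[of "snd c q"] by force
    then have "q \<in> K"
      unfolding K_def by (metis chart_inv_chart[OF A q(1)] imageI)
    then show False using that by simp
  qed
  have "smooth_on (chart_image d) (h \<circ> chart_inv d)" if d: "d \<in> A" for d
  proof (rule smooth_on_local)
    fix y assume y: "y \<in> chart_image d"
    define q where "q = chart_inv d y"
    have q: "q \<in> fst d" "snd d q = y"
      using chart_inv_in[OF A(1) d y] chart_chart_inv[OF A(1) d y] by (auto simp: q_def)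
    show "\<exists>T. open T \<and> y \<in> T \<and> smooth_on T (h \<circ> chart_inv d)"
    proof (cases "q \<in> fst c \<and> snd c q \<in> V")
      case True
      define U where "U = (fst c \<inter> snd c -` V) \<inter> fst d"
      define T where "T = snd d ` U"
      have "open U"
        unfolding U_def
        by (intro open_Int continuous_open_preimage continuous_on_chart[OF A] open_chart_domain[OF A]
            open_chart_domain[OF A(1) d] V(1))
      then have T: "open T" "T \<subseteq> snd d ` (fst d \<inter> fst c)"
        unfolding T_def using open_chart_image_subset[OF A(1) d, of U] by (auto simp: U_def)
      have "y \<in> T"
        using True q by (auto simp: T_def U_def)
      have trans: "transition d c y = snd c (chart_inv d y)" "chart_inv d y \<in> fst c"
        "transition d c y \<in> V" if "y \<in> T" for y
        using that chart_inv_chart[OF A(1) d] by (auto simp: transition_def T_def U_def)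
      have smooth_t: "smooth_on T (transition d c)"
        using A d T(2) smooth_on_subset unfolding smooth_atlas_def by blast
      have "smooth_on T (\<lambda>y. \<rho> (transition d c y) * H (transition d c y))"
        using trans(3)
        by (intro smooth_on_mult smooth_on_compose[OF T(1) open_UNIV _ smooth_t \<rho>(1)]
            smooth_on_compose[OF T(1) V(1) _ smooth_t H] T(1)) auto
      then have "smooth_on T (h \<circ> chart_inv d)"
        by (rule smooth_on_cong[OF T(1), rotated]) (use trans in \<open>simp add: h_def\<close>)
      then show ?thesis using T(1) \<open>y \<in> T\<close> by blast
    next
      case False
      define T where "T = snd d ` (fst d - K)"
      have "q \<notin> K"
      proof
        assume "q \<in> K"
        then obtain w where w: "w \<in> cball p (2 * r)" "q = chart_inv c w" by (auto simp: K_def)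
        then have "w \<in> chart_image c" "w \<in> V" using ballV V(2) by auto
        then show False
          using False w(2) chart_inv_in[OF A] chart_chart_inv[OF A] by auto
      qed
      then have "y \<in> T" using q by (auto simp: T_def)
      have "open T"
        unfolding T_def using openK open_chart_domain[OF A(1) d]
        by (intro open_chart_image_subset[OF A(1) d]) (auto simp: Diff_eq)
      moreover have "smooth_on T (h \<circ> chart_inv d)"
      proof (rule smooth_on_cong[OF \<open>open T\<close> _ smooth_on_const])
        show "0 = (h \<circ> chart_inv d) y" if "y \<in> T" for y
          using that h0 chart_inv_chart[OF A(1) d] by (auto simp: T_def)
      qed
      ultimately show ?thesis using \<open>y \<in> T\<close> by blast
    qed
  qed
  then have "smooth_function A h" by (simp add: smooth_function_def)
  moreover have "(h \<circ> chart_inv c) y = H y" if "y \<in> ball p r" for y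
  proof -
    have "y \<in> V" using that ballV r by (auto simp: subset_iff)
    then have "y \<in> chart_image c" using V(2) by auto
    then show ?thesis
      using \<open>y \<in> V\<close> \<rho>(2)[of y] that
      by (simp add: h_def chart_inv_in[OF A] chart_chart_inv[OF A])
  qed
  moreover have "ball p r \<subseteq> V" using ballV r by (auto simp: subset_iff)
  ultimately show thesis
    using that[of h "ball p r"] r by auto
qed

section \<open>The characterization of linearizability\<close>

theorem proposition1:
  fixes A :: "('q::{t2_space,second_countable_topology}, 'n::finite) chart set"
    and \<Gamma> :: "('q, 'n) chart \<Rightarrow> real^'n \<Rightarrow> real^'n^'n^'n"
    and e :: "('q, 'n) chart \<Rightarrow> real^'n \<Rightarrow> real^'n"
    and g :: "'m::finite \<Rightarrow> ('q, 'n) chart \<Rightarrow> real^'n \<Rightarrow> real^'n"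
    and c :: "('q, 'n) chart"
    and x0 :: 'q
  assumes "smooth_atlas A"
    and "symmetric_connection A \<Gamma>"
    and "smooth_vector_field A e"
    and "\<And>r. smooth_vector_field A (g r)"
    and "c \<in> A"
    and "x0 \<in> fst c"
  shows "mf_linearizable (chart_image c) (\<Gamma> c) (e c) (\<lambda>r. g r c) (snd c x0) \<longleftrightarrow>
    (\<exists>(h :: 'm \<Rightarrow> 'q \<Rightarrow> real) (\<nu> :: 'm \<Rightarrow> nat).
       (\<forall>l. smooth_function A (h l)) \<and>
       has_half_degree (e c) (\<lambda>r. g r c) (\<lambda>l. h l \<circ> chart_inv c) (snd c x0) \<nu> \<and>
       (\<Sum>l\<in>UNIV. \<nu> l) = CARD('n) \<and>
       (\<forall>\<^sub>F x in nhds (snd c x0). \<forall>l k. k + 2 \<le> \<nu> l \<longrightarrow>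
          nabla_d (\<Gamma> c) ((lie (e c) ^^ k) (h l \<circ> chart_inv c)) x = 0))"
    (is "?lin \<longleftrightarrow> (\<exists>h \<nu>. ?outputs h \<nu>)")
proof
  let ?S = "chart_image c" and ?p = "snd c x0"
  assume ?lin
  have sym: "\<Gamma> c x $ i $ j $ k = \<Gamma> c x $ i $ k $ j" if "x \<in> ?S" for x i j k
    using assms(2,5) that unfolding symmetric_connection_def by blast
  obtain V H \<nu> where V: "open V" "?p \<in> V" "V \<subseteq> ?S" and H: "\<And>l. smooth_on V (H l)"
    and \<nu>: "\<And>l. 1 \<le> \<nu> l" "(\<Sum>l\<in>UNIV. \<nu> l) = CARD('n)"
    and low: "\<And>x l r q. x \<in> V \<Longrightarrow> q + 2 \<le> \<nu> l \<Longrightarrow> lie (g r c) ((lie (e c) ^^ q) (H l)) x = 0"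
    and rank: "\<And>x. x \<in> V \<Longrightarrow> rank (decoupling_matrix (e c) (\<lambda>r. g r c) H \<nu> x) = CARD('m)"
    and flat: "\<And>x l k. x \<in> V \<Longrightarrow> k + 2 \<le> \<nu> l \<Longrightarrow> nabla_d (\<Gamma> c) ((lie (e c) ^^ k) (H l)) x = 0"
    by (rule mf_linearizable_imp_half_degree[OF sym \<open>?lin\<close>]) (assumption, rule that)
  have "\<exists>h W. smooth_function A h \<and> open W \<and> ?p \<in> W \<and> W \<subseteq> V \<and>
      (\<forall>y\<in>W. (h \<circ> chart_inv c) y = H l y)" for l
    by (rule smooth_function_extension[OF assms(1,5) V(2,1,3) H[of l]]) blast
  then obtain h W where h: "\<And>l. smooth_function A (h l)"
    and W: "\<And>l. open (W l)" "\<And>l. ?p \<in> W l" "\<And>l. W l \<subseteq> V"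
    and hH: "\<And>l y. y \<in> W l \<Longrightarrow> (h l \<circ> chart_inv c) y = H l y"
    by metis
  define U where "U = (\<Inter>l. W l)"
  have U: "open U" "?p \<in> U" "U \<subseteq> V"
    using W by (auto simp: U_def) (metis subsetD)
  have iter: "(lie (e c) ^^ k) (h l \<circ> chart_inv c) x = (lie (e c) ^^ k) (H l) x" if "x \<in> U" for k l x
    by (rule lie_funpow_cong_open[OF U(1) hH that]) (simp add: U_def)
  have lie_iter: "lie (g r c) ((lie (e c) ^^ k) (h l \<circ> chart_inv c)) x =
      lie (g r c) ((lie (e c) ^^ k) (H l)) x" if "x \<in> U" for r k l x
    by (rule lie_cong_open[OF U(1) that iter])
  have near: "\<forall>\<^sub>F x in nhds ?p. x \<in> U"
    using U by (intro eventually_nhds_in_open)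
  have "has_half_degree (e c) (\<lambda>r. g r c) (\<lambda>l. h l \<circ> chart_inv c) ?p \<nu>"
    unfolding has_half_degree_def
  proof (intro conjI allI)
    show "1 \<le> \<nu> l" for l by (rule \<nu>(1))
    show "\<forall>\<^sub>F x in nhds ?p. \<forall>l r q. q + 2 \<le> \<nu> l \<longrightarrow>
        lie (g r c) ((lie (e c) ^^ q) (h l \<circ> chart_inv c)) x = 0"
      using near U(3) by (auto elim!: eventually_mono simp: lie_iter low subset_iff)
    have "decoupling_matrix (e c) (\<lambda>r. g r c) (\<lambda>l. h l \<circ> chart_inv c) \<nu> x =
        decoupling_matrix (e c) (\<lambda>r. g r c) H \<nu> x" if "x \<in> U" for x
      unfolding decoupling_matrix_def lie_iter[OF that] ..
    then show "\<forall>\<^sub>F x in nhds ?p.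
        rank (decoupling_matrix (e c) (\<lambda>r. g r c) (\<lambda>l. h l \<circ> chart_inv c) \<nu> x) = CARD('m)"
      using near U(3) by (auto elim!: eventually_mono simp: rank subset_iff)
  qed
  moreover have "nabla_d (\<Gamma> c) ((lie (e c) ^^ k) (h l \<circ> chart_inv c)) x =
      nabla_d (\<Gamma> c) ((lie (e c) ^^ k) (H l)) x" if "x \<in> U" for k l x
    by (rule nabla_d_cong_open[OF U(1) that iter])
  then have "\<forall>\<^sub>F x in nhds ?p. \<forall>l k. k + 2 \<le> \<nu> l \<longrightarrow>
      nabla_d (\<Gamma> c) ((lie (e c) ^^ k) (h l \<circ> chart_inv c)) x = 0"
    using near U(3) by (auto elim!: eventually_mono simp: flat subset_iff)
  ultimately have "?outputs h \<nu>"
    using h \<nu>(2) by simp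
  then show "\<exists>h \<nu>. ?outputs h \<nu>" by (intro exI)
next
  assume "\<exists>h \<nu>. ?outputs h \<nu>"
  then obtain h \<nu> where out: "?outputs h \<nu>" by (elim exE)
  show ?lin
  proof (rule half_degree_imp_mf_linearizable[where h="\<lambda>l. h l \<circ> chart_inv c" and \<nu>=\<nu>])
    show "open (chart_image c)" "snd c x0 \<in> chart_image c"
      using open_chart_image[OF assms(1,5)] chart_in[OF assms(1,5,6)] .
    show "smooth_on (chart_image c) (\<Gamma> c)"
      using assms(2,5) unfolding symmetric_connection_def by blast
    show "smooth_on (chart_image c) (e c)" "smooth_on (chart_image c) (g r c)" for r
      using assms(3,4,5) unfolding smooth_vector_field_def by blast+
    show "smooth_on (chart_image c) (h l \<circ> chart_inv c)" for l
      using out assms(5) unfolding smooth_function_def by blast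
  qed (use out in blast)+
qed

end
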